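(* Let $\Gamma$ be a connected metric graph and let $D=K+\mathrm{div}(f)$ be an effective canonical divisor on $\Gamma$. If there are no two disjoint horizontal cycles in $\Gamma$ (possibly of different heights, i.e. with different values of $f$), then $D$ is realizable.
   Context: Metric graph: the geometric realization of a finite graph with positive edge lengths; $\mathrm{val}(x)$ is the number of half-edges at $x$; a model has a finite vertex set $V$ whose complement is a disjoint union of open intervals (edges). All vertex weights are zero. A divisor is a finite formal sum $D=\sum_xD(x)\,x$, $D(x)\in\mathbb Z$; effective if all $D(x)\ge0$. $K=\sum_x(\mathrm{val}(x)-2)\,x$. A rational function is a continuous piecewise linear $f:\Gamma\to\mathbb R$ with integer slopes; $\mathrm{ord}_x(f)$ is the sum of the outgoing slopes at $x$; $\mathrm{div}(f)=\sum_x\mathrm{ord}_x(f)\,x$. A horizontal cycle is a cycle of $\Gamma$ on which $f$ is constant; two cycles are disjoint if they do not intersect. Realizability: an effective canonical divisor $D=K+\mathrm{div}(f)$ is realizable if $(\Gamma,D)$ arises as the tropicalization of a curve with an effective canonical divisor; by a theorem of Möller–Ulirsch–Werner this is equivalent to the following criterion, taken here as the definition. Use a model of $\Gamma$ whose vertex set contains $\{x:\mathrm{ord}_x(f)\ne0\}$. A vertex $v$ with outgoing slopes $s_1,\dots,s_r$ of $f$ along its adjacent edges is inconvenient if all $s_j\neq0$ and some $s_i<0$ satisfies $-s_i>\sum_{s_j>0}s_j$. An edge is horizontal if $f$ is constant on it. $D$ is realizable iff every inconvenient vertex $v$ is contained in a simple cycle $Z$ (closed path without self-intersection) with $f\ge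 f(v)$ on $Z$, and every horizontal edge $e$ is contained in a simple cycle $Z$ with $f\ge f(e)$ on $Z$. *)

theory Defs
  imports "HOL-Analysis.Analysis"
begin

section \<open>Metric graphs\<close>

text \<open>
  A finite multigraph, loops and parallel edges allowed, with positive edge lengths.
  The orientation of an edge from \<open>src\<close> to \<open>tgt\<close> is arbitrary; it only serves to
  parametrise the edge by the interval from 0 to its length.
\<close>

record ('v, 'e) metric_graph =
  verts :: "'v set"
  edges :: "'e set"
  src :: "'e \<Rightarrow> 'v"
  tgt :: "'e \<Rightarrow> 'v"
  len :: "'e \<Rightarrow> real"

definition metric_graph :: "('v, 'e) metric_graph \<Rightarrow> bool" where
  "metric_graph \<Gamma> \<longleftrightarrow> finite (verts \<Gamma>) \<and> finite (edges \<Gamma>) \<and>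
     (\<forall>e\<in>edges \<Gamma>. src \<Gamma> e \<in> verts \<Gamma> \<and> tgt \<Gamma> e \<in> verts \<Gamma> \<and> 0 < len \<Gamma> e)"

datatype ('v, 'e) point = Vertex 'v | Inner 'e real

definition points :: "('v, 'e) metric_graph \<Rightarrow> ('v, 'e) point set" where
  "points \<Gamma> = Vertex ` verts \<Gamma> \<union> {Inner e t | e t. e \<in> edges \<Gamma> \<and> 0 < t \<and> t < len \<Gamma> e}"

definition edge_pt :: "('v, 'e) metric_graph \<Rightarrow> 'e \<Rightarrow> real \<Rightarrow> ('v, 'e) point" where
  "edge_pt \<Gamma> e t =
     (if t \<le> 0 then Vertex (src \<Gamma> e) else if len \<Gamma> e \<le> t then Vertex (tgt \<Gamma> e) else Inner e t)"

text \<open>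
  The geometric realization carries the quotient topology of the disjoint union of the
  closed intervals (and of the vertices); for a finite graph this is the topology of
  the path metric.
\<close>

definition realization :: "('v, 'e) metric_graph \<Rightarrow> ('v, 'e) point topology" where
  "realization \<Gamma> = topology (\<lambda>U. U \<subseteq> points \<Gamma> \<and>
     (\<forall>e\<in>edges \<Gamma>. openin (top_of_set {0..len \<Gamma> e}) {t \<in> {0..len \<Gamma> e}. edge_pt \<Gamma> e t \<in> U}))"

lemma openin_realization:
  "openin (realization \<Gamma>) U \<longleftrightarrow> U \<subseteq> points \<Gamma> \<and>
     (\<forall>e\<in>edges \<Gamma>. openin (top_of_set {0..len \<Gamma> e}) {t \<in> {0..len \<Gamma> e}. edge_pt \<Gamma> e t \<in> U})"
proof -
  have "istopology (\<lambda>U. U \<subseteq> points \<Gamma> \<and>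
     (\<forall>e\<in>edges \<Gamma>. openin (top_of_set {0..len \<Gamma> e}) {t \<in> {0..len \<Gamma> e}. edge_pt \<Gamma> e t \<in> U}))"
    (is "istopology ?P")
    unfolding istopology_def
  proof (intro conjI allI impI)
    fix U V assume *: "?P U" "?P V"
    have "{t \<in> {0..len \<Gamma> e}. edge_pt \<Gamma> e t \<in> U \<inter> V} =
      {t \<in> {0..len \<Gamma> e}. edge_pt \<Gamma> e t \<in> U} \<inter> {t \<in> {0..len \<Gamma> e}. edge_pt \<Gamma> e t \<in> V}" for e
      by auto
    then show "U \<inter> V \<subseteq> points \<Gamma>"
      "\<forall>e\<in>edges \<Gamma>. openin (top_of_set {0..len \<Gamma> e}) {t \<in> {0..len \<Gamma> e}. edge_pt \<Gamma> e t \<in> U \<inter> V}"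
      using * by (auto intro: openin_Int)
  next
    fix \<U> assume *: "\<forall>U\<in>\<U>. ?P U"
    have "{t \<in> {0..len \<Gamma> e}. edge_pt \<Gamma> e t \<in> \<Union>\<U>} =
      (\<Union>U\<in>\<U>. {t \<in> {0..len \<Gamma> e}. edge_pt \<Gamma> e t \<in> U})" for e
      by auto
    then show "\<Union>\<U> \<subseteq> points \<Gamma>"
      "\<forall>e\<in>edges \<Gamma>. openin (top_of_set {0..len \<Gamma> e}) {t \<in> {0..len \<Gamma> e}. edge_pt \<Gamma> e t \<in> \<Union>\<U>}"
      using * by auto
  qed
  then show ?thesis
    unfolding realization_def by (simp add: topology_inverse')
qed

lemma edge_pt_in_points:
  "metric_graph \<Gamma> \<Longrightarrow> e \<in> edges \<Gamma> \<Longrightarrow> edge_pt \<Gamma> e t \<in> points \<Gamma>"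
  by (auto simp: metric_graph_def edge_pt_def points_def)

lemma topspace_realization:
  assumes "metric_graph \<Gamma>"
  shows "topspace (realization \<Gamma>) = points \<Gamma>"
proof -
  have "{t \<in> {0..len \<Gamma> e}. edge_pt \<Gamma> e t \<in> points \<Gamma>} = {0..len \<Gamma> e}" if "e \<in> edges \<Gamma>" for e
    using edge_pt_in_points[OF assms that] by auto
  then have "openin (realization \<Gamma>) (points \<Gamma>)"
    unfolding openin_realization by auto
  then show ?thesis
    by (metis openin_realization openin_subset openin_topspace subset_antisym)
qed

text \<open>
  The model of \<open>\<Gamma>\<close> with vertex set \<open>S\<close>: its edges are the connected components of the complement
  of \<open>S\<close>.
\<close>

definition model_edges ::
  "('v, 'e) metric_graph \<Rightarrow> ('v, 'e) point set \<Rightarrow> ('v, 'e) point set set" where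
  "model_edges \<Gamma> S = connected_components_of (subtopology (realization \<Gamma>) (points \<Gamma> - S))"

definition is_model :: "('v, 'e) metric_graph \<Rightarrow> ('v, 'e) point set \<Rightarrow> bool" where
  "is_model \<Gamma> S \<longleftrightarrow> finite S \<and> S \<subseteq> points \<Gamma> \<and>
     (\<forall>E\<in>model_edges \<Gamma> S.
        subtopology (realization \<Gamma>) E homeomorphic_space top_of_set {0<..<1::real})"

definition simple_cycle :: "('v, 'e) metric_graph \<Rightarrow> ('v, 'e) point set \<Rightarrow> bool" where
  "simple_cycle \<Gamma> Z \<longleftrightarrow>
     (\<exists>g. pathin (realization \<Gamma>) g \<and> g 0 = g 1 \<and> inj_on g {0..<1} \<and> Z = g ` {0..1})"


section \<open>Rational functions and divisors\<close>

text \<open>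
  A half-edge at a point is a triple \<open>(e, t, \<sigma>)\<close>: leave the point with parameter \<open>t\<close> on the edge \<open>e\<close>
  in the direction \<open>\<sigma>\<close> = 1 (towards the target) or \<open>\<sigma>\<close> = -1 (towards the source). A loop contributes
  two half-edges at its vertex, and a point in the interior of an edge has two half-edges.
\<close>

definition half_edges ::
  "('v, 'e) metric_graph \<Rightarrow> ('v, 'e) point \<Rightarrow> ('e \<times> real \<times> real) set" where
  "half_edges \<Gamma> x = {(e, t, \<sigma>). e \<in> edges \<Gamma> \<and> 0 \<le> t \<and> t \<le> len \<Gamma> e \<and> edge_pt \<Gamma> e t = x \<and>
     (\<sigma> = 1 \<and> t < len \<Gamma> e \<or> \<sigma> = -1 \<and> 0 < t)}"

definition val :: "('v, 'e) metric_graph \<Rightarrow> ('v, 'e) point \<Rightarrow> nat" where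
  "val \<Gamma> x = card (half_edges \<Gamma> x)"

definition piecewise_int_affine :: "real \<Rightarrow> real \<Rightarrow> (real \<Rightarrow> real) \<Rightarrow> bool" where
  "piecewise_int_affine a b g \<longleftrightarrow> (\<exists>T. finite T \<and>
     (\<forall>s t. a \<le> s \<longrightarrow> s < t \<longrightarrow> t \<le> b \<longrightarrow> {s<..<t} \<inter> T = {} \<longrightarrow>
        (\<exists>m::int. \<forall>u\<in>{s..t}. g u = g s + of_int m * (u - s))))"

definition rational_function ::
  "('v, 'e) metric_graph \<Rightarrow> (('v, 'e) point \<Rightarrow> real) \<Rightarrow> bool" where
  "rational_function \<Gamma> f \<longleftrightarrow> continuous_map (realization \<Gamma>) euclideanreal f \<and>
     (\<forall>e\<in>edges \<Gamma>. piecewise_int_affine 0 (len \<Gamma> e) (\<lambda>t. f (edge_pt \<Gamma> e t)))"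

text \<open>The outgoing slope along a half-edge; it exists and is unique for rational functions.\<close>

definition slope ::
  "('v, 'e) metric_graph \<Rightarrow> (('v, 'e) point \<Rightarrow> real) \<Rightarrow> 'e \<times> real \<times> real \<Rightarrow> int" where
  "slope \<Gamma> f = (\<lambda>(e, t, \<sigma>). THE m::int.
     \<forall>\<^sub>F s in at_right 0. f (edge_pt \<Gamma> e (t + \<sigma> * s)) = f (edge_pt \<Gamma> e t) + of_int m * s)"

definition ord_at ::
  "('v, 'e) metric_graph \<Rightarrow> (('v, 'e) point \<Rightarrow> real) \<Rightarrow> ('v, 'e) point \<Rightarrow> int" where
  "ord_at \<Gamma> f x = (\<Sum>h\<in>half_edges \<Gamma> x. slope \<Gamma> f h)"

text \<open>Divisors are coefficient functions with finite support, zero outside \<open>points \<Gamma>\<close>.\<close>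

definition is_divisor :: "('v, 'e) metric_graph \<Rightarrow> (('v, 'e) point \<Rightarrow> int) \<Rightarrow> bool" where
  "is_divisor \<Gamma> D \<longleftrightarrow> {x. D x \<noteq> 0} \<subseteq> points \<Gamma> \<and> finite {x. D x \<noteq> 0}"

definition effective :: "(('v, 'e) point \<Rightarrow> int) \<Rightarrow> bool" where
  "effective D \<longleftrightarrow> (\<forall>x. 0 \<le> D x)"

definition canonical_divisor :: "('v, 'e) metric_graph \<Rightarrow> ('v, 'e) point \<Rightarrow> int" where
  "canonical_divisor \<Gamma> x = (if x \<in> points \<Gamma> then int (val \<Gamma> x) - 2 else 0)"

definition principal_divisor ::
  "('v, 'e) metric_graph \<Rightarrow> (('v, 'e) point \<Rightarrow> real) \<Rightarrow> ('v, 'e) point \<Rightarrow> int" where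
  "principal_divisor \<Gamma> f x = (if x \<in> points \<Gamma> then ord_at \<Gamma> f x else 0)"

lemma half_edges_Inner:
  assumes "e \<in> edges \<Gamma>" "0 < t" "t < len \<Gamma> e"
  shows "half_edges \<Gamma> (Inner e t) = {(e, t, 1), (e, t, -1)}"
  using assms by (auto simp: half_edges_def edge_pt_def split: if_splits)

lemma slope_eqI:
  assumes "\<forall>\<^sub>F s in at_right 0.
    f (edge_pt \<Gamma> e (t + \<sigma> * s)) = f (edge_pt \<Gamma> e t) + of_int m * s"
  shows "slope \<Gamma> f (e, t, \<sigma>) = m"
  unfolding slope_def prod.case
proof (rule the_equality)
  fix n :: int
  assume "\<forall>\<^sub>F s in at_right 0.
    f (edge_pt \<Gamma> e (t + \<sigma> * s)) = f (edge_pt \<Gamma> e t) + of_int n * s"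
  with assms have "\<forall>\<^sub>F s in at_right (0::real). of_int m * s = of_int n * s \<and> 0 < s"
    using eventually_at_right_less[of "0::real"] by eventually_elim auto
  then obtain s :: real where "of_int m * s = of_int n * s" "0 < s"
    using eventually_happens trivial_limit_at_right_real by blast
  then show "n = m" by simp
qed (use assms in auto)

lemma is_divisor_canonical:
  assumes "metric_graph \<Gamma>"
  shows "is_divisor \<Gamma> (canonical_divisor \<Gamma>)"
proof -
  have "canonical_divisor \<Gamma> (Inner e t) = 0" for e t
  proof (cases "Inner e t \<in> points \<Gamma>")
    case True
    then have "half_edges \<Gamma> (Inner e t) = {(e, t, 1), (e, t, -1)}"
      by (intro half_edges_Inner) (auto simp: points_def)
    then show ?thesis by (simp add: canonical_divisor_def val_def)
  qed (simp add: canonical_divisor_def)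
  moreover have "{x. canonical_divisor \<Gamma> x \<noteq> 0} \<subseteq> points \<Gamma>"
    by (auto simp: canonical_divisor_def)
  ultimately have *: "{x. canonical_divisor \<Gamma> x \<noteq> 0} \<subseteq> Vertex ` verts \<Gamma>"
    unfolding points_def by blast
  then have "finite {x. canonical_divisor \<Gamma> x \<noteq> 0}"
    using assms by (meson finite_imageI finite_subset metric_graph_def)
  with * show ?thesis by (auto simp: is_divisor_def points_def)
qed

lemma is_divisor_principal:
  assumes G: "metric_graph \<Gamma>" and f: "rational_function \<Gamma> f"
  shows "is_divisor \<Gamma> (principal_divisor \<Gamma> f)"
proof -
  have "\<forall>e\<in>edges \<Gamma>. \<exists>T. finite T \<and> (\<forall>s t. 0 \<le> s \<longrightarrow> s < t \<longrightarrow> t \<le> len \<Gamma> e \<longrightarrow> {s<..<t} \<inter> T = {} \<longrightarrow>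
        (\<exists>m::int. \<forall>u\<in>{s..t}. f (edge_pt \<Gamma> e u) = f (edge_pt \<Gamma> e s) + of_int m * (u - s)))"
    using f by (simp add: rational_function_def piecewise_int_affine_def)
  then obtain T where T: "\<And>e. e \<in> edges \<Gamma> \<Longrightarrow> finite (T e)"
    and lin: "\<And>e s t. e \<in> edges \<Gamma> \<Longrightarrow> 0 \<le> s \<Longrightarrow> s < t \<Longrightarrow> t \<le> len \<Gamma> e \<Longrightarrow> {s<..<t} \<inter> T e = {} \<Longrightarrow>
        \<exists>m::int. \<forall>u\<in>{s..t}. f (edge_pt \<Gamma> e u) = f (edge_pt \<Gamma> e s) + of_int m * (u - s)"
    by metis
  have zero: "ord_at \<Gamma> f (Inner e t) = 0"
    if e: "e \<in> edges \<Gamma>" and t: "0 < t" "t < len \<Gamma> e" "t \<notin> T e" for e t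
  proof -
    have "open ({0<..<len \<Gamma> e} - T e)"
      using T[OF e] by (intro open_Diff finite_imp_closed) auto
    with t obtain d where d: "0 < d" "cball t d \<subseteq> {0<..<len \<Gamma> e} - T e"
      by (meson DiffI greaterThanLessThan_iff open_contains_cball)
    have sub: "{t-d..t+d} \<subseteq> {0<..<len \<Gamma> e} - T e"
      using d(2) by (simp add: cball_eq_atLeastAtMost)
    then have "t - d \<in> {0<..<len \<Gamma> e}" "t + d \<in> {0<..<len \<Gamma> e}"
      using subsetD[OF sub, of "t - d"] subsetD[OF sub, of "t + d"] d(1) by auto
    moreover have "{t-d<..<t+d} \<inter> T e = {}"
    proof -
      have "{t-d<..<t+d} \<subseteq> {t-d..t+d}" by auto
      with sub show ?thesis by blast
    qed
    ultimately have "\<exists>m::int. \<forall>u\<in>{t-d..t+d}.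
        f (edge_pt \<Gamma> e u) = f (edge_pt \<Gamma> e (t-d)) + of_int m * (u - (t-d))"
      using d(1) by (intro lin[OF e]) auto
    then obtain m :: int where m: "\<And>u. u \<in> {t-d..t+d} \<Longrightarrow>
        f (edge_pt \<Gamma> e u) = f (edge_pt \<Gamma> e (t-d)) + of_int m * (u - (t-d))"
      by blast
    have ev: "\<forall>\<^sub>F s in at_right 0. 0 < s \<and> s < d"
      using d(1) by (auto simp: eventually_at_right_field)
    have m': "f (edge_pt \<Gamma> e (t + r)) = f (edge_pt \<Gamma> e t) + of_int m * r" if "\<bar>r\<bar> < d" for r
    proof -
      have "t + r \<in> {t-d..t+d}" "t \<in> {t-d..t+d}" using that by auto
      from m[OF this(1)] m[OF this(2)] show ?thesis by (simp only: algebra_simps)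
    qed
    have "slope \<Gamma> f (e, t, 1) = m"
    proof (rule slope_eqI, rule eventually_mono[OF ev])
      fix s :: real assume "0 < s \<and> s < d"
      then show "f (edge_pt \<Gamma> e (t + 1 * s)) = f (edge_pt \<Gamma> e t) + of_int m * s"
        using m'[of s] by simp
    qed
    moreover have "slope \<Gamma> f (e, t, -1) = -m"
    proof (rule slope_eqI, rule eventually_mono[OF ev])
      fix s :: real assume "0 < s \<and> s < d"
      then show "f (edge_pt \<Gamma> e (t + -1 * s)) = f (edge_pt \<Gamma> e t) + of_int (-m) * s"
        using m'[of "-s"] by simp
    qed
    ultimately show ?thesis
      using e t by (simp add: ord_at_def half_edges_Inner)
  qed
  have "{x. principal_divisor \<Gamma> f x \<noteq> 0} \<subseteq>
      Vertex ` verts \<Gamma> \<union> (\<Union>e\<in>edges \<Gamma>. Inner e ` T e)"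
  proof
    fix x assume "x \<in> {x. principal_divisor \<Gamma> f x \<noteq> 0}"
    then have "x \<in> points \<Gamma>" "ord_at \<Gamma> f x \<noteq> 0"
      by (auto simp: principal_divisor_def split: if_splits)
    then show "x \<in> Vertex ` verts \<Gamma> \<union> (\<Union>e\<in>edges \<Gamma>. Inner e ` T e)"
      unfolding points_def using zero by blast
  qed
  moreover have "finite (Vertex ` verts \<Gamma> \<union> (\<Union>e\<in>edges \<Gamma>. Inner e ` T e))"
    using G T by (auto simp: metric_graph_def)
  ultimately have "finite {x. principal_divisor \<Gamma> f x \<noteq> 0}"
    by (rule finite_subset)
  then show ?thesis
    by (auto simp: is_divisor_def principal_divisor_def split: if_splits)
qed

definition horizontal_cycle ::
  "('v, 'e) metric_graph \<Rightarrow> (('v, 'e) point \<Rightarrow> real) \<Rightarrow> ('v, 'e) point set \<Rightarrow> bool" where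
  "horizontal_cycle \<Gamma> f Z \<longleftrightarrow> simple_cycle \<Gamma> Z \<and> (\<exists>c. \<forall>x\<in>Z. f x = c)"


section \<open>Realizability\<close>

definition inconvenient ::
  "('v, 'e) metric_graph \<Rightarrow> (('v, 'e) point \<Rightarrow> real) \<Rightarrow> ('v, 'e) point \<Rightarrow> bool" where
  "inconvenient \<Gamma> f v \<longleftrightarrow>
     (\<forall>h\<in>half_edges \<Gamma> v. slope \<Gamma> f h \<noteq> 0) \<and>
     (\<exists>i\<in>half_edges \<Gamma> v. slope \<Gamma> f i < 0 \<and>
        - slope \<Gamma> f i > (\<Sum>j | j \<in> half_edges \<Gamma> v \<and> slope \<Gamma> f j > 0. slope \<Gamma> f j))"

text \<open>
  The criterion of Moeller, Ulirsch and Werner for \<open>D = K + div f\<close>. It does not depend on the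
  chosen model, and we require it for every model whose vertex set contains the support of
  \<open>div f\<close>. (Such models exist: take \<open>Vertex ` verts \<Gamma>\<close> together with this support.)
\<close>

definition realizable ::
  "('v, 'e) metric_graph \<Rightarrow> (('v, 'e) point \<Rightarrow> int) \<Rightarrow> (('v, 'e) point \<Rightarrow> real) \<Rightarrow> bool" where
  "realizable \<Gamma> D f \<longleftrightarrow>
     rational_function \<Gamma> f \<and>
     D = (\<lambda>x. canonical_divisor \<Gamma> x + principal_divisor \<Gamma> f x) \<and> effective D \<and>
     (\<forall>S. is_model \<Gamma> S \<and> {x \<in> points \<Gamma>. ord_at \<Gamma> f x \<noteq> 0} \<subseteq> S \<longrightarrow>
        (\<forall>v\<in>S. inconvenient \<Gamma> f v \<longrightarrow>
           (\<exists>Z. simple_cycle \<Gamma> Z \<and> v \<in> Z \<and> (\<forall>x\<in>Z. f v \<le> f x))) \<and>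
        (\<forall>E\<in>model_edges \<Gamma> S. \<forall>c. (\<forall>y\<in>E. f y = c) \<longrightarrow>
           (\<exists>Z. simple_cycle \<Gamma> Z \<and> E \<subseteq> Z \<and> (\<forall>x\<in>Z. c \<le> f x))))"

end

theory Submission
  imports Defs
begin

text \<open>
  Let \<open>e\<close> be a horizontal edge, or \<open>v\<close> an inconvenient vertex, at height \<open>c\<close>. Effectiveness at \<open>v\<close> forces at
  least two ascending half-edges there. If no simple cycle in the region \<open>f \<ge> c\<close> passes through \<open>e\<close>
  (or \<open>v\<close>), then removing \<open>e\<close> (or \<open>v\<close>) separates the two ends of \<open>e\<close> (or two ascending neighbours of
  \<open>v\<close>) within this region. Consider the top level of \<open>f\<close> on either of the two resulting components:
  no slope is positive there, so effectiveness leaves at least two horizontal half-edges at each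
  point, one of which can be lost only at an end of \<open>e\<close>. Hence each top level contains a cycle, and
  the two cycles are disjoint and horizontal.

  The cycles are found in a finite simple graph obtained by subdividing the edges. An edge of an
  arbitrary model is homeomorphic to an open interval and meets a simple cycle in a clopen subset,
  so it lies on the cycle as soon as it contains one of its points.
\<close>


section \<open>Arcs and loops\<close>

definition join_at :: "(real \<Rightarrow> 'a) \<Rightarrow> (real \<Rightarrow> 'a) \<Rightarrow> real \<Rightarrow> 'a" where
  "join_at g h = (\<lambda>t. if t \<le> 1/2 then g (2 * t) else h (2 * t - 1))"

lemma pathin_affine:
  assumes "pathin X g" "\<And>t. t \<in> {0..1} \<Longrightarrow> a + b * t \<in> {0..1}"
  shows "pathin X (\<lambda>t. g (a + b * t))"
proof -
  have "pathin X (g \<circ> (\<lambda>t. a + b * t))"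
    unfolding pathin_def
  proof (rule continuous_map_compose)
    show "continuous_map (top_of_set {0..1}) (top_of_set {0..1}) (\<lambda>t. a + b * t)"
      using assms(2) by (auto intro!: continuous_intros simp: continuous_map_in_subtopology)
    show "continuous_map (top_of_set {0..1}) X g"
      using assms(1) by (simp add: pathin_def)
  qed
  then show ?thesis by (simp add: comp_def)
qed

lemma pathin_join_at:
  assumes g: "pathin X g" and h: "pathin X h" and gh: "g 1 = h 0"
  shows "pathin X (join_at g h)"
proof -
  have g': "continuous_map (top_of_set {0..1/2}) X (g \<circ> (\<lambda>t. 2 * t))"
  proof (rule continuous_map_compose)
    show "continuous_map (top_of_set {0..1/2}) (top_of_set {0..1}) (\<lambda>t::real. 2 * t)"
      by (auto intro!: continuous_intros simp: continuous_map_in_subtopology)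
  qed (use g in \<open>simp add: pathin_def\<close>)
  have h': "continuous_map (top_of_set {1/2..1}) X (h \<circ> (\<lambda>t. 2 * t - 1))"
  proof (rule continuous_map_compose)
    show "continuous_map (top_of_set {1/2..1}) (top_of_set {0..1}) (\<lambda>t::real. 2 * t - 1)"
      by (auto intro!: continuous_intros simp: continuous_map_in_subtopology)
  qed (use h in \<open>simp add: pathin_def\<close>)
  have sets: "{0..1} \<inter> {x::real. 0 \<le> x \<and> x \<le> 1 \<and> x * 2 \<le> 1} = {0..1/2}"
    "{0..1} \<inter> {x::real. 0 \<le> x \<and> x \<le> 1 \<and> 1 \<le> x * 2} = {1/2..1}"
    by auto
  have "continuous_map (top_of_set {0..1}) X
      (\<lambda>t. if t \<le> 1/2 then (g \<circ> (\<lambda>t. 2 * t)) t else (h \<circ> (\<lambda>t. 2 * t - 1)) t)"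
    by (rule continuous_map_cases_le)
      (use g' h' gh in \<open>auto simp: subtopology_subtopology sets comp_def mult.commute[of 2]\<close>)
  then show ?thesis
    unfolding pathin_def join_at_def comp_def .
qed

lemma image_join_at:
  assumes "g 1 = h 0"
  shows "join_at g h ` {0..1} = g ` {0..1} \<union> h ` {0..1}"
proof (intro equalityI subsetI)
  fix x assume "x \<in> join_at g h ` {0..1}"
  then obtain t where t: "0 \<le> t" "t \<le> 1" "x = join_at g h t" by auto
  show "x \<in> g ` {0..1} \<union> h ` {0..1}"
  proof (cases "t \<le> 1/2")
    case True
    then have "x = g (2 * t)" "2 * t \<in> {0..1}" using t by (auto simp: join_at_def)
    then show ?thesis by blast
  next
    case False
    then have "x = h (2 * t - 1)" "2 * t - 1 \<in> {0..1}" using t by (auto simp: join_at_def)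
    then show ?thesis by blast
  qed
next
  fix x assume "x \<in> g ` {0..1} \<union> h ` {0..1}"
  then show "x \<in> join_at g h ` {0..1}"
  proof
    assume "x \<in> g ` {0..1}"
    then obtain t where "0 \<le> t" "t \<le> 1" "x = g t" by auto
    then show ?thesis by (intro image_eqI[of _ _ "t/2"]) (auto simp: join_at_def)
  next
    assume "x \<in> h ` {0..1}"
    then obtain t where "0 \<le> t" "t \<le> 1" "x = h t" by auto
    then show ?thesis using assms
      by (intro image_eqI[of _ _ "(t+1)/2"]) (auto simp: join_at_def add_divide_distrib)
  qed
qed

text \<open>One statement serves arcs (\<open>I = {0..1}\<close>) and loops
  (\<open>I = {0..<1}\<close>): the start of \<open>g\<close> may coincide with the end of
  \<open>h\<close> only if the final time 1 is left out of \<open>I\<close>.\<close>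

lemma inj_on_join_at:
  assumes g: "inj_on g {0..1}" and h: "inj_on h {0..1}"
    and meet: "\<And>s t. \<lbrakk>s \<in> {0..1}; t \<in> {0..1}; g s = h t\<rbrakk> \<Longrightarrow> s = 1 \<and> t = 0 \<or> s = 0 \<and> t = 1 \<and> 1 \<notin> I"
    and I: "I \<subseteq> {0..1}"
  shows "inj_on (join_at g h) I"
proof (rule linorder_inj_onI)
  fix s t assume st: "s < t" "s \<in> I" "t \<in> I"
  then have "0 \<le> s" "t \<le> 1" using I by auto
  consider "t \<le> 1/2" | "1/2 < s" | "s \<le> 1/2" "1/2 < t" by linarith
  then show "join_at g h s \<noteq> join_at g h t"
  proof cases
    case 1
    then show ?thesis using inj_onD[OF g, of "2 * s" "2*t"] st \<open>0 \<le> s\<close> by (auto simp: join_at_def)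
  next
    case 2
    then show ?thesis using inj_onD[OF h, of "2 * s-1" "2*t-1"] st \<open>t \<le> 1\<close> by (auto simp: join_at_def)
  next
    case 3
    then show ?thesis using meet[of "2 * s" "2*t-1"] st \<open>0 \<le> s\<close> \<open>t \<le> 1\<close> by (auto simp: join_at_def)
  qed
qed auto

text \<open>Carrying the image \<open>A\<close> along and hiding the parametrisation turns the
  gluing of arcs into a condition on intersections of sets.\<close>

definition arc_in :: "'a topology \<Rightarrow> 'a set \<Rightarrow> 'a \<Rightarrow> 'a \<Rightarrow> bool" where
  "arc_in X A x y \<longleftrightarrow> (\<exists>g. pathin X g \<and> inj_on g {0..1} \<and> g 0 = x \<and> g 1 = y \<and> A = g ` {0..1})"

lemma arc_in_sym:
  assumes "arc_in X A x y"
  shows "arc_in X A y x"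
proof -
  obtain g where g: "pathin X g" "inj_on g {0..1}" "g 0 = x" "g 1 = y" "A = g ` {0..1}"
    using assms unfolding arc_in_def by blast
  have "pathin X (\<lambda>t. g (1 - t))"
    using pathin_affine[OF g(1), of 1 "-1"] by simp
  moreover have "inj_on (\<lambda>t. g (1 - t)) {0..1}"
  proof (rule inj_onI)
    fix s t :: real assume "s \<in> {0..1}" "t \<in> {0..1}" "g (1 - s) = g (1 - t)"
    then show "s = t" using inj_onD[OF g(2), of "1-s" "1-t"] by auto
  qed
  moreover have "A = (\<lambda>t. g (1 - t)) ` {0..1}"
    unfolding g(5) by (auto simp: image_iff intro!: bexI[of _ "1 - _"])
  ultimately show ?thesis
    unfolding arc_in_def using g(3,4) by (intro exI[of _ "\<lambda>t. g (1 - t)"]) simp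
qed

lemma arc_in_join:
  assumes "arc_in X A x y" "arc_in X B y z" "A \<inter> B \<subseteq> {y}"
  shows "arc_in X (A \<union> B) x z"
proof -
  obtain g where g: "pathin X g" "inj_on g {0..1}" "g 0 = x" "g 1 = y" "A = g ` {0..1}"
    using assms(1) unfolding arc_in_def by blast
  obtain h where h: "pathin X h" "inj_on h {0..1}" "h 0 = y" "h 1 = z" "B = h ` {0..1}"
    using assms(2) unfolding arc_in_def by blast
  have "inj_on (join_at g h) {0..1}"
  proof (rule inj_on_join_at[OF g(2) h(2)])
    fix s t :: real assume st: "s \<in> {0..1}" "t \<in> {0..1}" "g s = h t"
    then have "g s \<in> A \<inter> B" unfolding g(5) h(5) by (metis IntI imageI)
    then have "g s = g 1" "h t = h 0" using assms(3) g h st(3) by auto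
    then have "s = 1" "t = 0"
      using inj_onD[OF g(2), of s 1] inj_onD[OF h(2), of t 0] st by auto
    then show "s = 1 \<and> t = 0 \<or> s = 0 \<and> t = 1 \<and> 1 \<notin> {0..1::real}" by simp
  qed simp
  then show ?thesis
    unfolding arc_in_def using g h pathin_join_at[of X g h] image_join_at[of g h]
    by (intro exI[of _ "join_at g h"]) (auto simp: join_at_def)
qed

text \<open>The arcs may share both ends, so the concatenation fails to be injective only in
  returning to \<open>x\<close> at time 1. The conclusion has the shape of
  \<open>simple_cycle\<close>.\<close>

lemma arc_in_close_loop:
  assumes "arc_in X A x y" "arc_in X B y x" "A \<inter> B \<subseteq> {x, y}"
  shows "\<exists>g. pathin X g \<and> g 0 = g 1 \<and> inj_on g {0..<1} \<and> A \<union> B = g ` {0..1}"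
proof -
  obtain g where g: "pathin X g" "inj_on g {0..1}" "g 0 = x" "g 1 = y" "A = g ` {0..1}"
    using assms(1) unfolding arc_in_def by blast
  obtain h where h: "pathin X h" "inj_on h {0..1}" "h 0 = y" "h 1 = x" "B = h ` {0..1}"
    using assms(2) unfolding arc_in_def by blast
  have "inj_on (join_at g h) {0..<1}"
  proof (rule inj_on_join_at[OF g(2) h(2)])
    fix s t :: real assume st: "s \<in> {0..1}" "t \<in> {0..1}" "g s = h t"
    then have "g s \<in> A \<inter> B" unfolding g(5) h(5) by (metis IntI imageI)
    then have "g s = g 0 \<and> h t = h 1 \<or> g s = g 1 \<and> h t = h 0" using assms(3) g h st(3) by auto
    then show "s = 1 \<and> t = 0 \<or> s = 0 \<and> t = 1 \<and> 1 \<notin> {0..<1::real}"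
      using inj_onD[OF g(2), of s 1] inj_onD[OF h(2), of t 0]
       inj_onD[OF g(2), of s 0] inj_onD[OF h(2), of t 1] st by auto
  qed auto
  then show ?thesis
    using g h pathin_join_at[of X g h] image_join_at[of g h]
    by (intro exI[of _ "join_at g h"]) (auto simp: join_at_def)
qed

text \<open>Prepares for invariance of domain, which needs an open set of parameters around a
  preimage of \<open>z\<close>. Only the base point of the loop lacks one, and starting the loop
  halfway moves it to an interior parameter.\<close>

lemma loop_reparam_interior:
  assumes g: "pathin X g" "g 0 = g 1" "inj_on g {0..<1}" and z: "z \<in> g ` {0..1}"
  obtains h s where "pathin X h" "inj_on h {0<..<1}" "h ` {0..1} \<subseteq> g ` {0..1}"
    "0 < s" "s < 1" "h s = z"
proof (cases "z = g 0")
  case False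
  obtain s where s: "0 \<le> s" "s \<le> 1" "g s = z" using z by auto
  with False g(2) have "s \<noteq> 0" "s \<noteq> 1" by auto
  with s have "0 < s" "s < 1" "g s = z" by auto
  moreover have "inj_on g {0<..<1}"
    using g(3) by (rule inj_on_subset) auto
  ultimately show ?thesis using that g(1) by blast
next
  case True
  \<comment> \<open>The second half of the loop comes first, so the base point is passed at time
    1/2.\<close>
  define h1 where "h1 = (\<lambda>t. g (1/2 + 1/2 * t))"
  define h2 where "h2 = (\<lambda>t. g (0 + 1/2 * t))"
  have p: "pathin X h1" "pathin X h2"
    unfolding h1_def h2_def by (rule pathin_affine[OF g(1)]; simp)+
  have eq: "h1 1 = h2 0" using g(2) by (simp add: h1_def h2_def)
  show ?thesis
  proof (rule that)
    show "pathin X (join_at h1 h2)" using p eq by (rule pathin_join_at)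
    show "join_at h1 h2 ` {0..1} \<subseteq> g ` {0..1}"
      unfolding image_join_at[where g=h1 and h=h2, OF eq] by (auto simp: h1_def h2_def)
    show "join_at h1 h2 (1/2) = z" using True g(2) by (simp add: join_at_def h1_def)
    show "inj_on (join_at h1 h2) {0<..<1}"
    proof (rule inj_onI)
      fix s t :: real assume st: "s \<in> {0<..<1}" "t \<in> {0<..<1}" "join_at h1 h2 s = join_at h1 h2 t"
      \<comment> \<open>Rotation by 1/2 modulo 1. It sends 1/2 to 0 rather than 1, so its values
        stay where \<open>g\<close> is injective; \<open>g 0 = g 1\<close> reconciles this with
        \<open>join_at\<close>.\<close>
      define r :: "real \<Rightarrow> real" where
        "r = (\<lambda>t. if t < 1/2 then 1/2 + t else t - 1/2)"
      have r: "join_at h1 h2 t = g (r t)" "r t \<in> {0..<1}" if "t \<in> {0<..<1}" for t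
        using that g(2) by (auto simp: join_at_def h1_def h2_def r_def field_simps)
      have "r s = r t"
        using st r[of s] r[of t] inj_onD[OF g(3), of "r s" "r t"] by auto
      then show "s = t" using st(1,2) by (auto simp: r_def split: if_splits)
    qed
  qed auto
qed

text \<open>By invariance of domain a loop is a neighbourhood, within the interval, of each of its points
  on the interval; hence it meets the interval in a clopen set.\<close>

lemma open_interval_subset_loop:
  assumes hom: "subtopology X E homeomorphic_space top_of_set {0<..<1::real}"
    and conn: "connectedin X E" and op: "openin X E"
    and g: "pathin X g" "g 0 = g 1" "inj_on g {0..<1}"
    and cl: "closedin X (g ` {0..1})" and meet: "g ` {0..1} \<inter> E \<noteq> {}"
  shows "E \<subseteq> g ` {0..1}"
proof -
  let ?Z = "g ` {0..1}"
  let ?Y = "subtopology X E"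
  have E: "E \<subseteq> topspace X" using conn by (simp add: connectedin_def)
  then have tE: "topspace ?Y = E" by auto
  obtain \<phi> \<psi> where hm: "homeomorphic_maps ?Y (top_of_set {0<..<1::real}) \<phi> \<psi>"
    using hom unfolding homeomorphic_space_def by blast
  have \<phi>: "continuous_map ?Y (top_of_set {0<..<1}) \<phi>" and \<psi>: "continuous_map (top_of_set {0<..<1}) ?Y \<psi>"
    and \<psi>\<phi>: "\<And>x. x \<in> E \<Longrightarrow> \<psi> (\<phi> x) = x"
    using hm tE by (auto simp: homeomorphic_maps_def)
  have "openin ?Y (?Z \<inter> E)"
  proof (subst openin_subopen, intro ballI)
    fix z assume z: "z \<in> ?Z \<inter> E"
    obtain h s where h: "pathin X h" "inj_on h {0<..<1}" "h ` {0..1} \<subseteq> ?Z" "0 < s" "s < 1" "h s = z"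
      using loop_reparam_interior[OF g] z by (metis IntD1)
    \<comment> \<open>Only at times spent in \<open>E\<close> can the loop be composed with the
      chart \<open>\<phi>\<close>; these times form an open set because \<open>E\<close> is
      open.\<close>
    define J where "J = {t \<in> {0<..<1}. h t \<in> E}"
    have ch: "continuous_map (top_of_set {0<..<1}) X h"
      using h(1) unfolding pathin_def by (rule continuous_map_from_subtopology_mono) auto
    have J: "open J" "s \<in> J"
      using openin_continuous_map_preimage[OF ch op] h(4-6) z
      by (auto simp: J_def openin_open_eq)
    have "continuous_map (top_of_set J) ?Y h"
      using continuous_map_from_subtopology_mono[OF ch, of J]
      by (auto simp: continuous_map_in_subtopology J_def subset_iff)
    from continuous_map_compose[OF this \<phi>]
    have cont: "continuous_on J (\<phi> \<circ> h)"
      by (auto simp: continuous_map_in_subtopology)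
    have inj: "inj_on (\<phi> \<circ> h) J"
    proof (rule comp_inj_on)
      show "inj_on h J" using h(2) by (rule inj_on_subset) (auto simp: J_def)
      show "inj_on \<phi> (h ` J)" by (intro inj_on_inverseI[of _ \<psi>] \<psi>\<phi>) (auto simp: J_def)
    qed
    \<comment> \<open>Pulling this open image back along \<open>\<phi>\<close> gives a neighbourhood
      of \<open>z\<close> in \<open>E\<close> that lies on the loop.\<close>
    have "open ((\<phi> \<circ> h) ` J)"
      using invariance_of_domain[OF cont J(1) inj] .
    then have "openin (top_of_set {0<..<1}) ({0<..<1} \<inter> (\<phi> \<circ> h) ` J)"
      by (rule openin_open_Int)
    from openin_continuous_map_preimage[OF \<phi> this]
    have "openin ?Y {x \<in> E. \<phi> x \<in> {0<..<1} \<inter> (\<phi> \<circ> h) ` J}"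
      unfolding tE .
    moreover have "\<phi> x \<in> {0<..<1}" if "x \<in> E" for x
      using continuous_map_funspace[OF \<phi>] that tE by (auto simp: Pi_iff)
    ultimately have "openin ?Y {x \<in> E. \<phi> x \<in> (\<phi> \<circ> h) ` J}"
      by (simp cong: conj_cong)
    moreover have "{x \<in> E. \<phi> x \<in> (\<phi> \<circ> h) ` J} \<subseteq> ?Z \<inter> E"
    proof safe
      fix x t assume x: "x \<in> E" "\<phi> x = (\<phi> \<circ> h) t" "t \<in> J"
      then have "h t \<in> E" by (simp add: J_def)
      then have "x = h t" using \<psi>\<phi> x by (metis comp_apply)
      then show "x \<in> ?Z" using h(3) x(3) by (auto simp: J_def)
    qed
    moreover have "z \<in> {x \<in> E. \<phi> x \<in> (\<phi> \<circ> h) ` J}"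
      using z h(6) J(2) by auto
    ultimately show "\<exists>T. openin ?Y T \<and> z \<in> T \<and> T \<subseteq> ?Z \<inter> E"
      by blast
  qed
  moreover have "closedin ?Y (?Z \<inter> E)"
    using cl by (auto simp: closedin_subtopology)
  moreover have "connected_space ?Y"
    using conn by (simp add: connectedin_def)
  ultimately have "?Z \<inter> E = E"
    using meet tE unfolding connected_space_clopen_in by metis
  then show ?thesis by blast
qed


section \<open>Cycles in finite graphs with a height function\<close>

text \<open>Length at least 3 rules out an edge run back and forth, which meets the other conditions
  when \<open>R\<close> is symmetric.\<close>

definition graph_cycle :: "('a \<Rightarrow> 'a \<Rightarrow> bool) \<Rightarrow> 'a list \<Rightarrow> bool" where
  "graph_cycle R cs \<longleftrightarrow> distinct cs \<and> 3 \<le> length cs \<and> successively R cs \<and> R (last cs) (hd cs)"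

text \<open>Whenever the walk returns to a vertex already listed, the path is cut back to that
  vertex, so no repetition arises.\<close>

lemma rtranclp_imp_distinct_path:
  assumes "R\<^sup>*\<^sup>* x y"
  shows "\<exists>xs. xs \<noteq> [] \<and> distinct xs \<and> successively R xs \<and> hd xs = x \<and> last xs = y"
  using assms
proof induction
  case base
  show ?case by (intro exI[of _ "[x]"]) simp
next
  case (step y z)
  then obtain xs where xs: "xs \<noteq> []" "distinct xs" "successively R xs" "hd xs = x" "last xs = y"
    by blast
  show ?case
  proof (cases "z \<in> set xs")
    case True
    then obtain us vs where "xs = us @ z # vs" by (auto simp: in_set_conv_decomp)
    then show ?thesis
      using xs by (intro exI[of _ "us @ [z]"]) (auto simp: successively_append_iff hd_append)
  next
    case False
    then show ?thesis
      using xs step.hyps(2) by (intro exI[of _ "xs @ [z]"]) (auto simp: successively_append_iff)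
  qed
qed

lemma successively_imp_rtranclp:
  assumes "successively R xs" "z \<in> set xs"
  shows "R\<^sup>*\<^sup>* (hd xs) z"
  using assms
proof (induction xs)
  case (Cons x xs)
  show ?case
  proof (cases "z = x")
    case False
    then have "z \<in> set xs" "xs \<noteq> []" using Cons.prems(2) by auto
    then have "R\<^sup>*\<^sup>* (hd xs) z" "R x (hd xs)"
      using Cons by (auto simp: successively_Cons)
    then show ?thesis by (simp add: converse_rtranclp_into_rtranclp)
  qed simp
qed simp

text \<open>The initial vertex of a longest path may have only one neighbour; the final one has a second
  neighbour, which closes up a cycle.\<close>

lemma ex_graph_cycle:
  assumes fin: "finite B" and irr: "\<And>x. \<not> R x x" and sym: "\<And>x y. R x y \<Longrightarrow> R y x"
    and start: "x0 \<in> B" "y0 \<in> B" "R x0 y0"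
    and deg: "\<And>x. x \<in> B \<Longrightarrow> x \<noteq> x0 \<Longrightarrow> \<exists>y z. y \<noteq> z \<and> y \<in> B \<and> z \<in> B \<and> R x y \<and> R x z"
  shows "\<exists>cs. graph_cycle R cs \<and> set cs \<subseteq> B"
proof -
  \<comment> \<open>The lists run backwards: each path starts at \<open>x0\<close>, its last entry,
    and is extended at the head.\<close>
  define Q where "Q = {ys. distinct ys \<and> set ys \<subseteq> B \<and> successively R ys \<and> ys \<noteq> [] \<and> last ys = x0}"
  have "finite Q"
    by (rule finite_subset[OF _ finite_subset_distinct[OF fin]]) (auto simp: Q_def)
  moreover have init: "[y0, x0] \<in> Q"
    using start sym irr by (auto simp: Q_def)
  ultimately obtain ys where ys: "ys \<in> Q" and max: "\<And>zs. zs \<in> Q \<Longrightarrow> length zs \<le> length ys"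
    using Max_ge[of "length ` Q"] Max_in[of "length ` Q"]
    by (metis (no_types, lifting) empty_iff finite_imageI image_iff)
  have "2 \<le> length ys" using max[OF init] by simp
  then obtain a b zs where yz: "ys = a # b # zs"
    by (metis One_nat_def Suc_1 Suc_le_length_iff)
  have "a \<noteq> x0" using ys by (auto simp: Q_def yz split: if_splits)
  moreover have "a \<in> B" using ys by (auto simp: Q_def yz)
  ultimately obtain c where c: "c \<noteq> b" "c \<in> B" "R a c" using deg by metis
  \<comment> \<open>Otherwise \<open>c\<close> would extend the longest path.\<close>
  have "c \<in> set ys"
  proof (rule ccontr)
    assume "c \<notin> set ys"
    then have "c # ys \<in> Q" using ys c sym[OF c(3)] by (auto simp: Q_def yz)
    then show False using max by fastforce
  qed
  moreover have "c \<noteq> a" using c irr by auto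
  ultimately obtain us vs where zs: "zs = us @ c # vs"
    using c(1) by (auto simp: yz in_set_conv_decomp)
  have "graph_cycle R (a # b # us @ [c])"
    using ys sym[OF c(3)]
    by (auto simp: graph_cycle_def Q_def yz zs successively_Cons successively_append_iff hd_append)
  moreover have "set (a # b # us @ [c]) \<subseteq> B" using ys by (auto simp: Q_def yz zs)
  ultimately show ?thesis by blast
qed

text \<open>\<open>flat_degree\<close> abstracts what effectiveness of \<open>K + div f\<close>
  means at a vertex without ascending neighbours; it is the only property of the divisor that enters
  the construction of horizontal cycles.\<close>

locale height_graph =
  fixes W :: "'a set" and R :: "'a \<Rightarrow> 'a \<Rightarrow> bool" and f :: "'a \<Rightarrow> real"
  assumes finite_W: "finite W"
    and R_in_W: "R x y \<Longrightarrow> y \<in> W"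
    and R_irrefl: "\<not> R x x"
    and R_sym: "R x y \<Longrightarrow> R y x"
    and flat_degree: "x \<in> W \<Longrightarrow> (\<And>y. R x y \<Longrightarrow> f y \<le> f x) \<Longrightarrow>
      \<exists>y z. y \<noteq> z \<and> R x y \<and> R x z \<and> f y = f x \<and> f z = f x"
begin

definition flat_cycle :: "'a list \<Rightarrow> bool" where
  "flat_cycle cs \<longleftrightarrow> graph_cycle R cs \<and> (\<exists>c. \<forall>x\<in>set cs. f x = c)"

text \<open>The top level of a set \<open>A\<close> has minimal horizontal degree 2, except possibly at \<open>p\<close>, as long
  as no edge other than \<open>p q\<close> leaves \<open>A\<close> from its top level without going down.\<close>

lemma ex_flat_cycle:
  assumes A: "A \<subseteq> W" "A \<noteq> {}"
    and closed: "\<And>x y. x \<in> A \<Longrightarrow> R x y \<Longrightarrow> y \<notin> A \<Longrightarrow>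
      (\<exists>a\<in>A. f y < f a) \<or> x = p \<and> y = q \<and> (\<exists>a\<in>A. f y \<le> f a)"
  shows "\<exists>cs. flat_cycle cs \<and> set cs \<subseteq> A"
proof -
  have finA: "finite A" using A(1) finite_W by (rule finite_subset)
  obtain m where m: "m \<in> A" and max: "\<And>x. x \<in> A \<Longrightarrow> f x \<le> f m"
    using Max_ge[of "f ` A"] Max_in[of "f ` A"] finA A(2)
    by (metis (no_types, lifting) finite_imageI image_iff image_is_empty)
  define B where "B = {x \<in> A. f x = f m}"
  \<comment> \<open>No neighbour of a top vertex is higher: inside \<open>A\<close> by maximality,
    outside \<open>A\<close> by \<open>closed\<close>.\<close>
  have two: "\<exists>y z. y \<noteq> z \<and> R x y \<and> R x z \<and> f y = f m \<and> f z = f m" if x: "x \<in> B" for x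
  proof -
    have "f y \<le> f x" if "R x y" for y
      using closed[of x y] that x max[of y] max by (fastforce simp: B_def)
    from flat_degree[OF _ this] show ?thesis using x A(1) by (auto simp: B_def)
  qed
  have stay: "y \<in> B" if "x \<in> B" "R x y" "f y = f m" "x \<noteq> p \<or> y \<noteq> q" for x y
    using closed[of x y] that max by (fastforce simp: B_def)
  \<comment> \<open>The exempted edge leaves from \<open>p\<close>, so \<open>p\<close>, if it lies
    on the top level, must be the one vertex that is allowed degree 1.\<close>
  define x0 where "x0 = (if p \<in> B then p else m)"
  have x0: "x0 \<in> B" using m by (auto simp: x0_def B_def)
  then obtain y0 where y0: "y0 \<in> B" "R x0 y0"
    using two[OF x0] stay[OF x0] by metis
  have "\<exists>cs. graph_cycle R cs \<and> set cs \<subseteq> B"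
  proof (rule ex_graph_cycle[where R = R and B = B, OF _ _ _ x0 y0])
    show "finite B" using finA by (simp add: B_def)
    fix x assume x: "x \<in> B" "x \<noteq> x0"
    then have "x \<noteq> p" by (auto simp: x0_def)
    then show "\<exists>y z. y \<noteq> z \<and> y \<in> B \<and> z \<in> B \<and> R x y \<and> R x z"
      using two[OF x(1)] stay[OF x(1)] by metis
  qed (use R_irrefl R_sym in auto)
  then obtain cs where "graph_cycle R cs" "set cs \<subseteq> B" by blast
  then show ?thesis by (intro exI[of _ cs]) (auto simp: flat_cycle_def B_def)
qed

lemma disjoint_reach:
  assumes "symp S" "\<not> S\<^sup>*\<^sup>* x y"
  shows "{z. S\<^sup>*\<^sup>* x z} \<inter> {z. S\<^sup>*\<^sup>* y z} = {}"
proof -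
  have "S\<^sup>*\<^sup>* x y" if "S\<^sup>*\<^sup>* x z" "S\<^sup>*\<^sup>* y z" for z
    using that assms(1) by (meson rtranclp_trans sympD symp_rtranclp)
  then show ?thesis using assms(2) by blast
qed

context
  assumes meet: "\<And>cs ds. flat_cycle cs \<Longrightarrow> flat_cycle ds \<Longrightarrow> set cs \<inter> set ds \<noteq> {}"
begin

text \<open>Delete the edge \<open>u v\<close> and everything below its height. If \<open>u\<close>
  and \<open>v\<close> fell into different components, each component would carry a flat cycle, and
  the two would be disjoint. So some path avoids the edge, and the edge closes it up.\<close>

lemma cycle_through_flat_edge:
  assumes uv: "R u v" "f u = f v"
  shows "\<exists>cs. graph_cycle R cs \<and> hd cs = u \<and> last cs = v \<and> (\<forall>x\<in>set cs. f u \<le> f x)"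
proof -
  define S where "S = (\<lambda>x y. R x y \<and> f u \<le> f x \<and> f u \<le> f y \<and> {x, y} \<noteq> {u, v})"
  have sym: "symp S" using R_sym by (auto simp: S_def symp_def)
  have reach: "z \<in> W \<and> f u \<le> f z" if "S\<^sup>*\<^sup>* w z" "w \<in> {u, v}" for w z
    using that by (induction rule: rtranclp_induct) (use uv R_in_W R_sym in \<open>auto simp: S_def\<close>)
  \<comment> \<open>Stated for the ends in either order, so that it covers both components; the
    deleted edge from \<open>w\<close> to \<open>w'\<close> is the exemption granted by
    \<open>ex_flat_cycle\<close>.\<close>
  have cyc: "\<exists>cs. flat_cycle cs \<and> set cs \<subseteq> {z. S\<^sup>*\<^sup>* w z}"
    if w: "{w, w'} = {u, v}" "\<not> S\<^sup>*\<^sup>* w w'" for w w'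
  proof (rule ex_flat_cycle[where p = w and q = w'])
    have wuv: "w \<in> {u, v}" "f w = f u" "f w' = f u" using w uv(2) by (auto simp: doubleton_eq_iff)
    then show "{z. S\<^sup>*\<^sup>* w z} \<subseteq> W" using reach by blast
    fix x y assume x: "x \<in> {z. S\<^sup>*\<^sup>* w z}" and xy: "R x y" "y \<notin> {z. S\<^sup>*\<^sup>* w z}"
    have "\<not> S x y" using x xy(2) by (auto dest: rtranclp.rtrancl_into_rtrancl)
    then consider "f y < f w" | "{x, y} = {w, w'}"
      using reach[of w x] x xy(1) wuv w(1) by (fastforce simp: S_def)
    then show "(\<exists>a\<in>{z. S\<^sup>*\<^sup>* w z}. f y < f a) \<or> x = w \<and> y = w' \<and> (\<exists>a\<in>{z. S\<^sup>*\<^sup>* w z}. f y \<le> f a)"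
    proof cases
      case 2
      then have "x = w" "y = w'" using x w(2) xy(2) by (auto simp: doubleton_eq_iff)
      then show ?thesis using wuv by auto
    qed auto
  qed auto
  have "S\<^sup>*\<^sup>* u v"
  proof (rule ccontr)
    assume n: "\<not> S\<^sup>*\<^sup>* u v"
    then have "\<not> S\<^sup>*\<^sup>* v u" using sym by (meson sympD symp_rtranclp)
    then show False
      using cyc[of u v] cyc[of v u] disjoint_reach[OF sym n] n meet by (fastforce simp: insert_commute)
  qed
  then obtain xs where xs: "xs \<noteq> []" "distinct xs" "successively S xs" "hd xs = u" "last xs = v"
    using rtranclp_imp_distinct_path by metis
  \<comment> \<open>A shorter path would be the deleted edge itself, which \<open>S\<close>
    forbids.\<close>
  have "3 \<le> length xs"
  proof -
    have "u \<noteq> v" using uv R_irrefl by auto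
    then show ?thesis
      using xs by (cases xs rule: remdups_adj.cases) (auto simp: S_def neq_Nil_conv split: if_splits)
  qed
  moreover have "successively R xs" using xs(3) by (rule successively_mono) (simp add: S_def)
  moreover have "\<forall>x\<in>set xs. f u \<le> f x"
    using successively_imp_rtranclp[OF xs(3)] xs(4) reach by auto
  ultimately show ?thesis
    using xs uv R_sym by (auto simp: graph_cycle_def)
qed

text \<open>Here the vertex \<open>v\<close> itself is deleted. Both neighbours lie strictly above
  \<open>v\<close>, so the top level of the component of either one loses no horizontal edge by the
  deletion. A path between the two neighbours is closed up through \<open>v\<close>.\<close>

lemma cycle_through_two_ascents:
  assumes va: "R v a" "f v < f a" and vb: "R v b" "f v < f b" and ab: "a \<noteq> b"
  shows "\<exists>cs. graph_cycle R cs \<and> v \<in> set cs \<and> (\<forall>x\<in>set cs. f v \<le> f x)"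
proof -
  define S where "S = (\<lambda>x y. R x y \<and> f v \<le> f x \<and> f v \<le> f y \<and> x \<noteq> v \<and> y \<noteq> v)"
  have sym: "symp S" using R_sym by (auto simp: S_def symp_def)
  have reach: "z \<in> W \<and> f v \<le> f z \<and> z \<noteq> v" if "S\<^sup>*\<^sup>* w z" "w \<in> {a, b}" for w z
    using that by (induction rule: rtranclp_induct) (use va vb R_in_W in \<open>auto simp: S_def\<close>)
  have cyc: "\<exists>cs. flat_cycle cs \<and> set cs \<subseteq> {z. S\<^sup>*\<^sup>* w z}" if w: "w \<in> {a, b}" for w
  proof (rule ex_flat_cycle)
    show "{z. S\<^sup>*\<^sup>* w z} \<subseteq> W" using reach w by blast
    fix x y assume x: "x \<in> {z. S\<^sup>*\<^sup>* w z}" and xy: "R x y" "y \<notin> {z. S\<^sup>*\<^sup>* w z}"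
    have "\<not> S x y" using x xy(2) by (auto dest: rtranclp.rtrancl_into_rtrancl)
    then have "f y \<le> f v"
      using reach[of w x] x xy(1) w by (auto simp: S_def)
    also have "f v < f w" using va vb w by auto
    \<comment> \<open>The exception is filled vacuously with \<open>p = q = v\<close>: no vertex of
      the component equals \<open>v\<close>.\<close>
    finally show "(\<exists>a\<in>{z. S\<^sup>*\<^sup>* w z}. f y < f a) \<or> x = v \<and> y = v \<and> (\<exists>a\<in>{z. S\<^sup>*\<^sup>* w z}. f y \<le> f a)"
      by auto
  qed auto
  have "S\<^sup>*\<^sup>* a b"
    using cyc[of a] cyc[of b] disjoint_reach[OF sym, of a b] meet by fastforce
  then obtain xs where xs: "xs \<noteq> []" "distinct xs" "successively S xs" "hd xs = a" "last xs = b"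
    using rtranclp_imp_distinct_path by metis
  have "2 \<le> length xs"
    using xs ab by (cases xs rule: remdups_adj.cases) auto
  moreover have "successively R xs" using xs(3) by (rule successively_mono) (simp add: S_def)
  moreover have "\<forall>x\<in>set xs. f v \<le> f x \<and> x \<noteq> v"
    using successively_imp_rtranclp[OF xs(3)] xs(4) reach by auto
  ultimately show ?thesis
    using xs va vb R_sym
    by (intro exI[of _ "v # xs"]) (auto simp: graph_cycle_def successively_Cons)
qed

end

end


section \<open>Subdivisions of a metric graph\<close>

lemma continuous_map_edge_pt:
  assumes "metric_graph \<Gamma>" "e \<in> edges \<Gamma>"
  shows "continuous_map (top_of_set {0..len \<Gamma> e}) (realization \<Gamma>) (edge_pt \<Gamma> e)"
  using assms unfolding continuous_map_def
  by (auto simp: topspace_realization edge_pt_in_points openin_realization)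

text \<open>This is local connectedness: a short interval of parameters around one that maps into
  \<open>E\<close> avoids the finitely many parameters over \<open>S\<close>, and its connected
  image then stays in the component \<open>E\<close>.\<close>

lemma openin_model_edge:
  assumes G: "metric_graph \<Gamma>" and S: "finite S" and E: "E \<in> model_edges \<Gamma> S"
  shows "openin (realization \<Gamma>) E"
  unfolding openin_realization
proof (intro conjI ballI)
  let ?X = "subtopology (realization \<Gamma>) (points \<Gamma> - S)"
  have EX: "E \<in> connected_components_of ?X" using E by (simp add: model_edges_def)
  have "E \<subseteq> topspace ?X" using EX by (rule connected_components_of_subset)
  then have ES: "E \<subseteq> points \<Gamma> - S" by simp
  then show "E \<subseteq> points \<Gamma>" by blast
  fix e assume e: "e \<in> edges \<Gamma>"
  let ?I = "{0..len \<Gamma> e}"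
  have fin: "finite {t \<in> ?I. edge_pt \<Gamma> e t \<in> S}"
  proof (rule finite_subset)
    show "{t \<in> ?I. edge_pt \<Gamma> e t \<in> S} \<subseteq> {0, len \<Gamma> e} \<union> Inner e -` S"
      by (auto simp: edge_pt_def split: if_splits)
    show "finite ({0, len \<Gamma> e} \<union> Inner e -` S)"
      using S by (auto intro!: finite_vimageI injI)
  qed
  have "openin (top_of_set ?I) (?I - {t \<in> ?I. edge_pt \<Gamma> e t \<in> S})"
    using finite_imp_closed[OF fin] by (intro openin_diff closed_subset) auto
  also have "?I - {t \<in> ?I. edge_pt \<Gamma> e t \<in> S} = {t \<in> ?I. edge_pt \<Gamma> e t \<notin> S}"
    by auto
  finally have N: "\<forall>t\<in>{t \<in> ?I. edge_pt \<Gamma> e t \<notin> S}.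
      \<exists>d>0. ball t d \<inter> ?I \<subseteq> {t \<in> ?I. edge_pt \<Gamma> e t \<notin> S}"
    unfolding openin_contains_ball by (rule conjunct2)
  have "\<exists>d>0. ball t d \<inter> ?I \<subseteq> {t \<in> ?I. edge_pt \<Gamma> e t \<in> E}"
    if t: "t \<in> ?I" "edge_pt \<Gamma> e t \<in> E" for t
  proof -
    obtain d where d: "0 < d" "ball t d \<inter> ?I \<subseteq> {t \<in> ?I. edge_pt \<Gamma> e t \<notin> S}"
      using N t ES by blast
    let ?C = "ball t d \<inter> ?I"
    have "connectedin (top_of_set ?I) ?C"
      by (auto simp: connectedin_subtopology intro!: convex_connected convex_Int)
    then have "connectedin (realization \<Gamma>) (edge_pt \<Gamma> e ` ?C)"
      by (rule connectedin_continuous_map_image[OF continuous_map_edge_pt[OF G e]])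
    then have "connectedin ?X (edge_pt \<Gamma> e ` ?C)"
      using d(2) edge_pt_in_points[OF G e] by (auto simp: connectedin_subtopology)
    moreover have "\<not> disjnt E (edge_pt \<Gamma> e ` ?C)"
      using t d(1) by (auto simp: disjnt_iff)
    ultimately have "edge_pt \<Gamma> e ` ?C \<subseteq> E"
      by (metis EX connected_components_of_maximal)
    then show ?thesis using d(1) by (intro exI[of _ d]) auto
  qed
  then show "openin (top_of_set ?I) {t \<in> ?I. edge_pt \<Gamma> e t \<in> E}"
    unfolding openin_contains_ball by (intro conjI ballI) (blast, simp)
qed

fun chain :: "('a \<Rightarrow> 'a \<Rightarrow> 'b set) \<Rightarrow> 'a list \<Rightarrow> 'b set" where
  "chain s [] = {}"
| "chain s [x] = {}"
| "chain s (x # y # zs) = s x y \<union> chain s (y # zs)"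

lemma in_chainE:
  assumes "z \<in> chain s xs" "successively R xs"
  obtains x y where "x \<in> set xs" "y \<in> set xs" "R x y" "z \<in> s x y"
  using assms by (induction s xs arbitrary: thesis rule: chain.induct) auto

text \<open>Two breakpoints in the interior of every edge make the subdivided graph simple.\<close>

locale subdivision =
  fixes \<Gamma> :: "('v, 'e) metric_graph" and f :: "('v, 'e) point \<Rightarrow> real" and P :: "'e \<Rightarrow> real set"
  assumes graph: "metric_graph \<Gamma>"
    and finite_P: "e \<in> edges \<Gamma> \<Longrightarrow> finite (P e)"
    and P_range: "e \<in> edges \<Gamma> \<Longrightarrow> P e \<subseteq> {0..len \<Gamma> e}"
    and P_ends: "e \<in> edges \<Gamma> \<Longrightarrow> {0, len \<Gamma> e} \<subseteq> P e"
    and P_inner: "e \<in> edges \<Gamma> \<Longrightarrow> \<exists>s\<in>P e. \<exists>t\<in>P e. 0 < s \<and> s < t \<and> t < len \<Gamma> e"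
    and affine: "e \<in> edges \<Gamma> \<Longrightarrow> a \<in> P e \<Longrightarrow> b \<in> P e \<Longrightarrow> a < b \<Longrightarrow> {a<..<b} \<inter> P e = {} \<Longrightarrow>
      \<exists>m::int. \<forall>u\<in>{a..b}. f (edge_pt \<Gamma> e u) = f (edge_pt \<Gamma> e a) + of_int m * (u - a)"
begin

definition piece :: "'e \<Rightarrow> real \<Rightarrow> real \<Rightarrow> bool" where
  "piece e a b \<longleftrightarrow> e \<in> edges \<Gamma> \<and> a \<in> P e \<and> b \<in> P e \<and> a < b \<and> {a<..<b} \<inter> P e = {}"

definition adj :: "('v, 'e) point \<Rightarrow> ('v, 'e) point \<Rightarrow> bool" where
  "adj x y \<longleftrightarrow> (\<exists>e a b. piece e a b \<and> {x, y} = {edge_pt \<Gamma> e a, edge_pt \<Gamma> e b})"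

text \<open>The union over all pieces with these ends makes \<open>seg\<close> symmetric without a
  choice; by \<open>piece_unique\<close> at most one piece contributes.\<close>

definition seg :: "('v, 'e) point \<Rightarrow> ('v, 'e) point \<Rightarrow> ('v, 'e) point set" where
  "seg x y = \<Union>{edge_pt \<Gamma> e ` {a..b} | e a b.
     piece e a b \<and> {x, y} = {edge_pt \<Gamma> e a, edge_pt \<Gamma> e b}}"

definition nodes :: "('v, 'e) point set" where
  "nodes = Vertex ` verts \<Gamma> \<union> (\<Union>e\<in>edges \<Gamma>. edge_pt \<Gamma> e ` P e)"

lemma pieceD:
  assumes "piece e a b"
  shows "e \<in> edges \<Gamma>" "a \<in> P e" "b \<in> P e" "a < b" "0 \<le> a" "b \<le> len \<Gamma> e"
    "\<And>t. t \<in> P e \<Longrightarrow> t \<le> a \<or> b \<le> t"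
proof -
  show *: "e \<in> edges \<Gamma>" "a \<in> P e" "b \<in> P e" "a < b" using assms by (auto simp: piece_def)
  show "0 \<le> a" "b \<le> len \<Gamma> e" using P_range[OF *(1)] *(2,3) by auto
  show "t \<le> a \<or> b \<le> t" if "t \<in> P e" for t
    using assms that by (auto simp: piece_def disjoint_iff) (meson not_le)
qed

lemma finite_nodes: "finite nodes"
  using graph finite_P by (auto simp: nodes_def metric_graph_def)

lemma nodes_subset_points: "nodes \<subseteq> points \<Gamma>"
  using edge_pt_in_points[OF graph] by (auto simp: nodes_def points_def)

lemma ex_piece_after:
  assumes e: "e \<in> edges \<Gamma>" and t: "t \<in> P e" "t < len \<Gamma> e"
  shows "\<exists>b. piece e t b"
proof -
  define H where "H = {u \<in> P e. t < u}"
  have H: "finite H" "len \<Gamma> e \<in> H" using finite_P[OF e] P_ends[OF e] t by (auto simp: H_def)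
  have "Min H \<in> H" using H by (intro Min_in) auto
  moreover have "Min H \<le> u" if "u \<in> H" for u using H(1) that by simp
  ultimately have "piece e t (Min H)" using e t by (force simp: piece_def H_def)
  then show ?thesis ..
qed

lemma ex_piece_before:
  assumes e: "e \<in> edges \<Gamma>" and t: "t \<in> P e" "0 < t"
  shows "\<exists>a. piece e a t"
proof -
  define L where "L = {u \<in> P e. u < t}"
  have L: "finite L" "0 \<in> L" using finite_P[OF e] P_ends[OF e] t by (auto simp: L_def)
  have "Max L \<in> L" using L by (intro Max_in) auto
  moreover have "u \<le> Max L" if "u \<in> L" for u using L(1) that by simp
  ultimately have "piece e (Max L) t" using e t by (force simp: piece_def L_def)
  then show ?thesis ..
qed

lemma ex_piece_containing:
  assumes e: "e \<in> edges \<Gamma>" and t: "0 \<le> t" "t < len \<Gamma> e"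
  shows "\<exists>a b. piece e a b \<and> t \<in> {a..b}"
proof -
  define L where "L = {u \<in> P e. u \<le> t}"
  have L: "finite L" "0 \<in> L" using finite_P[OF e] P_ends[OF e] t by (auto simp: L_def)
  have a: "Max L \<in> L" using L by (intro Max_in) auto
  then obtain b where b: "piece e (Max L) b"
    using ex_piece_after[OF e] t by (force simp: L_def)
  have "t \<le> b"
  proof (rule ccontr)
    assume "\<not> t \<le> b"
    then have "b \<in> L" using pieceD(3)[OF b] by (simp add: L_def)
    then show False using L(1) pieceD(4)[OF b] by (simp add: Max_ge leD)
  qed
  then show ?thesis using a b by (auto simp: L_def)
qed

text \<open>A point inside an edge determines the edge and the parameter, and distinct pieces of one
  edge meet only in breakpoints. At an end of an edge the parameter can only be an end of a
  piece.\<close>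

lemma piece_overlap:
  assumes p: "piece e a b" "piece e' a' b'" and s: "s \<in> {a..b}" "s' \<in> {a'..b'}"
    and eq: "edge_pt \<Gamma> e s = edge_pt \<Gamma> e' s'"
  shows "e = e' \<and> a = a' \<and> b = b' \<or> s \<in> {a, b} \<and> s' \<in> {a', b'}"
proof (cases "0 < s \<and> s < len \<Gamma> e")
  case True
  then have e: "e' = e" and s': "s' = s" using eq by (auto simp: edge_pt_def split: if_splits)
  note d = pieceD[OF p(1)] and d' = pieceD[OF p(2)[unfolded e]]
  have "a' \<le> a \<or> b \<le> a'" "b' \<le> a \<or> b \<le> b'" "a \<le> a' \<or> b' \<le> a" "b \<le> a' \<or> b' \<le> b"
    using d(7) d'(7) d(2,3) d'(2,3) by auto
  then show ?thesis using s d(4) d'(4) unfolding e s' by auto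
next
  case False
  then have "\<not> (0 < s' \<and> s' < len \<Gamma> e')" using eq by (auto simp: edge_pt_def split: if_splits)
  with False show ?thesis using pieceD(5,6)[OF p(1)] pieceD(5,6)[OF p(2)] s by auto
qed

text \<open>An interior breakpoint prevents a piece from being a whole loop.\<close>

lemma piece_ends_neq:
  assumes "piece e a b"
  shows "edge_pt \<Gamma> e a \<noteq> edge_pt \<Gamma> e b"
proof -
  note p = pieceD[OF assms]
  obtain s where "s \<in> P e" "0 < s" "s < len \<Gamma> e" using P_inner[OF p(1)] by force
  then have "0 < a \<or> b < len \<Gamma> e" using p(7)[of s] by auto
  then show ?thesis using p(4-6) by (auto simp: edge_pt_def)
qed

text \<open>Every piece has an end inside its edge, and that end fixes both the edge and the
  parameter.\<close>

lemma piece_unique: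
  assumes p: "piece e a b" "piece e' a' b'"
    and eq: "{edge_pt \<Gamma> e a, edge_pt \<Gamma> e b} = {edge_pt \<Gamma> e' a', edge_pt \<Gamma> e' b'}"
  shows "e = e' \<and> a = a' \<and> b = b'"
proof -
  note d = pieceD[OF p(1)] and d' = pieceD[OF p(2)]
  obtain s t where st: "s \<in> P e" "t \<in> P e" "0 < s" "s < t" "t < len \<Gamma> e" using P_inner[OF d(1)] by auto
  have inner: "edge_pt \<Gamma> e u = edge_pt \<Gamma> e' u' \<Longrightarrow> e' = e \<and> u' = u" if "0 < u" "u < len \<Gamma> e" for u u'
    using that by (auto simp: edge_pt_def split: if_splits)
  have outer: "u \<in> {0, len \<Gamma> e} \<and> u' \<in> {0, len \<Gamma> e}"
    if "edge_pt \<Gamma> e u = edge_pt \<Gamma> e u'" "u \<noteq> u'" "{u, u'} \<subseteq> {0..len \<Gamma> e}" for u u'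
    using that by (auto simp: edge_pt_def split: if_splits)
  have same: ?thesis if "e' = e" "a' = a \<or> b' = b"
    using that d(2-4) d'(2-4) d(7)[of a'] d(7)[of b'] d'(7)[of a] d'(7)[of b] by auto
  consider "edge_pt \<Gamma> e a = edge_pt \<Gamma> e' a'" "edge_pt \<Gamma> e b = edge_pt \<Gamma> e' b'" |
     "edge_pt \<Gamma> e a = edge_pt \<Gamma> e' b'" "edge_pt \<Gamma> e b = edge_pt \<Gamma> e' a'"
    using eq by (auto simp: doubleton_eq_iff)
  then show ?thesis
  proof cases
    case 1
    then show ?thesis
      using same inner[of a a'] inner[of b b'] d(4-6) d(7)[of s] st by auto
  next
    case 2
    have e': "e' = e" and "b' = a \<or> a' = b"
      using inner[of a b'] inner[of b a'] 2 d(4-6) d(7)[of s] st by auto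
    \<comment> \<open>With crossed ends the two pieces would be the halves of a loop with a single
      interior breakpoint, while \<open>P_inner\<close> provides two.\<close>
    then have False
    proof (elim disjE)
      assume "b' = a"
      then have "a' = 0" "b = len \<Gamma> e"
        using outer[of b a'] 2(2) d(4-6) d'(4-6) by (auto simp: e')
      then show False using d(7)[of s] d'(7)[of s] d(7)[of t] d'(7)[of t] st \<open>b' = a\<close> e' by auto
    next
      assume "a' = b"
      then have "a = 0" "b' = len \<Gamma> e"
        using outer[of a b'] 2(1) d(4-6) d'(4-6) by (auto simp: e')
      then show False using d(7)[of s] d'(7)[of s] d(7)[of t] d'(7)[of t] st \<open>a' = b\<close> e' by auto
    qed
    then show ?thesis ..
  qed
qed

lemma adj_sym: "adj x y \<Longrightarrow> adj y x"
  by (simp add: adj_def insert_commute)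

lemma seg_commute: "seg x y = seg y x"
  by (simp add: seg_def insert_commute)

lemma piece_adj: "piece e a b \<Longrightarrow> adj (edge_pt \<Gamma> e a) (edge_pt \<Gamma> e b)"
  by (auto simp: adj_def)

lemma seg_piece:
  assumes "piece e a b"
  shows "seg (edge_pt \<Gamma> e a) (edge_pt \<Gamma> e b) = edge_pt \<Gamma> e ` {a..b}"
proof
  show "seg (edge_pt \<Gamma> e a) (edge_pt \<Gamma> e b) \<subseteq> edge_pt \<Gamma> e ` {a..b}"
    unfolding seg_def using piece_unique[OF assms] by blast
  show "edge_pt \<Gamma> e ` {a..b} \<subseteq> seg (edge_pt \<Gamma> e a) (edge_pt \<Gamma> e b)"
    unfolding seg_def using assms by blast
qed

lemma adjE:
  assumes "adj x y"
  obtains e a b where "piece e a b" "{x, y} = {edge_pt \<Gamma> e a, edge_pt \<Gamma> e b}"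
    "seg x y = edge_pt \<Gamma> e ` {a..b}"
proof -
  obtain e a b where *: "piece e a b" "{x, y} = {edge_pt \<Gamma> e a, edge_pt \<Gamma> e b}"
    using assms by (auto simp: adj_def)
  moreover from *(2) have "seg x y = edge_pt \<Gamma> e ` {a..b}"
    using seg_piece[OF *(1)] by (auto simp: doubleton_eq_iff seg_commute)
  ultimately show ?thesis by (rule that)
qed

lemma adj_irrefl: "\<not> adj x x"
  using piece_ends_neq by (fastforce simp: adj_def doubleton_eq_iff)

lemma adj_in_nodes: "adj x y \<Longrightarrow> y \<in> nodes"
  by (auto simp: adj_def nodes_def doubleton_eq_iff piece_def)

lemma ends_in_seg:
  assumes "adj x y"
  shows "x \<in> seg x y" "y \<in> seg x y"
proof -
  obtain e a b where *: "piece e a b" "{x, y} = {edge_pt \<Gamma> e a, edge_pt \<Gamma> e b}"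
    "seg x y = edge_pt \<Gamma> e ` {a..b}"
    using adjE[OF assms] .
  have "{x, y} \<subseteq> seg x y" using pieceD(4)[OF *(1)] unfolding *(2,3) by auto
  then show "x \<in> seg x y" "y \<in> seg x y" by auto
qed

lemma seg_meet:
  assumes "adj x y" "adj u w" "{x, y} \<noteq> {u, w}"
  shows "seg x y \<inter> seg u w \<subseteq> {x, y} \<inter> {u, w}"
proof
  fix z assume z: "z \<in> seg x y \<inter> seg u w"
  obtain e a b where p: "piece e a b" "{x, y} = {edge_pt \<Gamma> e a, edge_pt \<Gamma> e b}"
    "seg x y = edge_pt \<Gamma> e ` {a..b}"
    using adjE[OF assms(1)] .
  obtain e' a' b' where p': "piece e' a' b'" "{u, w} = {edge_pt \<Gamma> e' a', edge_pt \<Gamma> e' b'}"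
    "seg u w = edge_pt \<Gamma> e' ` {a'..b'}"
    using adjE[OF assms(2)] .
  obtain s s' where s: "s \<in> {a..b}" "s' \<in> {a'..b'}" "z = edge_pt \<Gamma> e s" "z = edge_pt \<Gamma> e' s'"
    using z p(3) p'(3) by auto
  have "\<not> (e = e' \<and> a = a' \<and> b = b')" using assms(3) p(2) p'(2) by auto
  then have "s \<in> {a, b}" "s' \<in> {a', b'}"
    using piece_overlap[OF p(1) p'(1) s(1,2)] s(3,4) by auto
  then show "z \<in> {x, y} \<inter> {u, w}" unfolding p(2) p'(2) using s(3,4) by auto
qed

text \<open>By affinity on a piece. This carries height bounds from the vertices of a graph cycle to
  the whole curve.\<close>

lemma f_on_seg:
  assumes "adj x y" "z \<in> seg x y"
  shows "min (f x) (f y) \<le> f z" "f z \<le> max (f x) (f y)"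
proof -
  obtain e a b where p: "piece e a b" "{x, y} = {edge_pt \<Gamma> e a, edge_pt \<Gamma> e b}"
    "seg x y = edge_pt \<Gamma> e ` {a..b}"
    using adjE[OF assms(1)] .
  obtain s where s: "s \<in> {a..b}" "z = edge_pt \<Gamma> e s" using assms(2) p(3) by auto
  obtain m :: int where m: "\<And>u. u \<in> {a..b} \<Longrightarrow> f (edge_pt \<Gamma> e u) = f (edge_pt \<Gamma> e a) + of_int m * (u - a)"
    using affine p(1) unfolding piece_def by blast
  have b: "f (edge_pt \<Gamma> e b) = f (edge_pt \<Gamma> e a) + of_int m * (b - a)"
    and z: "f z = f (edge_pt \<Gamma> e a) + of_int m * (s - a)"
    using m[of b] m[of s] s pieceD(4)[OF p(1)] by auto
  have "0 \<le> of_int m * (s - a) \<and> of_int m * (s - a) \<le> of_int m * (b - a) \<or>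
      of_int m * (b - a) \<le> of_int m * (s - a) \<and> of_int m * (s - a) \<le> 0"
    using s by (cases "0 \<le> m") (auto simp: mult_left_mono mult_left_mono_neg mult_nonneg_nonneg mult_nonpos_nonneg)
  then have "min (f (edge_pt \<Gamma> e a)) (f (edge_pt \<Gamma> e b)) \<le> f z \<and> f z \<le> max (f (edge_pt \<Gamma> e a)) (f (edge_pt \<Gamma> e b))"
    unfolding b z by (auto simp: min_def max_def)
  then show "min (f x) (f y) \<le> f z" "f z \<le> max (f x) (f y)"
    using p(2) by (auto simp: doubleton_eq_iff min.commute max.commute)
qed

lemma arc_in_seg:
  assumes "adj x y"
  shows "arc_in (realization \<Gamma>) (seg x y) x y"
proof -
  obtain e a b where p: "piece e a b" "{x, y} = {edge_pt \<Gamma> e a, edge_pt \<Gamma> e b}"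
    "seg x y = edge_pt \<Gamma> e ` {a..b}"
    using adjE[OF assms] .
  note d = pieceD[OF p(1)]
  let ?g = "edge_pt \<Gamma> e \<circ> (\<lambda>t. a + (b - a) * t)"
  have rng: "(\<lambda>t. a + (b - a) * t) ` {0..1} = {a..b}"
  proof (intro equalityI subsetI)
    fix x assume "x \<in> (\<lambda>t. a + (b - a) * t) ` {0..1}"
    then obtain t where t: "0 \<le> t" "t \<le> 1" "x = a + (b - a) * t" by auto
    then have "0 \<le> (b - a) * t" "(b - a) * t \<le> b - a"
      using d(4) mult_left_le[of t "b - a"] by auto
    then show "x \<in> {a..b}" unfolding t(3) by simp
  next
    fix x assume "x \<in> {a..b}"
    then show "x \<in> (\<lambda>t. a + (b - a) * t) ` {0..1}"
      using d(4) by (intro image_eqI[of _ _ "(x - a) / (b - a)"]) (auto simp: divide_simps)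
  qed
  have "arc_in (realization \<Gamma>) (seg x y) (edge_pt \<Gamma> e a) (edge_pt \<Gamma> e b)"
    unfolding arc_in_def
  proof (intro exI[of _ ?g] conjI)
    show "pathin (realization \<Gamma>) ?g"
      unfolding pathin_def
    proof (rule continuous_map_compose)
      show "continuous_map (top_of_set {0..1}) (top_of_set {0..len \<Gamma> e}) (\<lambda>t. a + (b - a) * t)"
      proof -
        have "(\<lambda>t. a + (b - a) * t) ` {0..1} \<subseteq> {0..len \<Gamma> e}" unfolding rng using d(5,6) by auto
        then show ?thesis
          by (auto intro!: continuous_intros simp: continuous_map_in_subtopology image_subset_iff)
      qed
    qed (rule continuous_map_edge_pt[OF graph d(1)])
    show "inj_on ?g {0..1}"
    proof (rule comp_inj_on)
      show "inj_on (\<lambda>t. a + (b - a) * t) {0..1}" by (rule inj_onI) (use d(4) in simp)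
      \<comment> \<open>\<open>edge_pt\<close> identifies at most the two ends of an edge, and no
        piece is a whole loop.\<close>
      show "inj_on (edge_pt \<Gamma> e) ((\<lambda>t. a + (b - a) * t) ` {0..1})"
        unfolding rng
      proof (rule inj_onI)
        fix s t assume "s \<in> {a..b}" "t \<in> {a..b}" "edge_pt \<Gamma> e s = edge_pt \<Gamma> e t"
        then show "s = t"
          using d(4-6) piece_ends_neq[OF p(1)]
          by (simp add: edge_pt_def split: if_splits)
      qed
    qed
    show "seg x y = ?g ` {0..1}" unfolding p(3) image_comp[symmetric] rng ..
  qed auto
  then show ?thesis using p(2) arc_in_sym by (auto simp: doubleton_eq_iff)
qed

lemma closedin_seg:
  assumes "adj x y"
  shows "closedin (realization \<Gamma>) (seg x y)"
proof -
  obtain e a b where p: "piece e a b" "{x, y} = {edge_pt \<Gamma> e a, edge_pt \<Gamma> e b}"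
    "seg x y = edge_pt \<Gamma> e ` {a..b}"
    using adjE[OF assms] .
  note d = pieceD[OF p(1)]
  have sub: "seg x y \<subseteq> points \<Gamma>" using p(3) edge_pt_in_points[OF graph d(1)] by auto
  have "openin (realization \<Gamma>) (points \<Gamma> - seg x y)"
    unfolding openin_realization
  proof (intro conjI ballI)
    fix e' assume e': "e' \<in> edges \<Gamma>"
    let ?I = "{0..len \<Gamma> e'}"
    let ?F = "{t \<in> ?I. edge_pt \<Gamma> e' t \<in> seg x y}"
    \<comment> \<open>On its own edge the segment pulls back to the piece; any further parameters
      are ends of edges, mapped to a vertex on the segment.\<close>
    have "?F = (if e' = e then {a..b} else {}) \<union> (?F \<inter> {0, len \<Gamma> e'})" (is "_ = ?R")
    proof
      show "?F \<subseteq> ?R"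
      proof
        fix t assume t: "t \<in> ?F"
        then obtain s where "s \<in> {a..b}" "edge_pt \<Gamma> e' t = edge_pt \<Gamma> e s" using p(3) by auto
        then show "t \<in> ?R" using t by (auto simp: edge_pt_def split: if_splits)
      qed
      show "?R \<subseteq> ?F" using d(5,6) p(3) by auto
    qed
    moreover have "closed ?R" by (intro closed_Un) (simp_all add: finite_imp_closed)
    ultimately have "closed ?F" by simp
    then have "openin (top_of_set ?I) (?I - ?F)" by (intro openin_diff closed_subset) auto
    moreover have "{t \<in> ?I. edge_pt \<Gamma> e' t \<in> points \<Gamma> - seg x y} = ?I - ?F"
      using edge_pt_in_points[OF graph e'] by auto
    ultimately show "openin (top_of_set ?I) {t \<in> ?I. edge_pt \<Gamma> e' t \<in> points \<Gamma> - seg x y}"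
      by simp
  qed auto
  then show ?thesis
    using sub by (simp add: closedin_def topspace_realization[OF graph])
qed

lemma closedin_chain: "successively adj xs \<Longrightarrow> closedin (realization \<Gamma>) (chain seg xs)"
  by (induction xs rule: induct_list012) (simp_all add: closedin_seg closedin_Un)

text \<open>Segments meet only in common ends, and \<open>u\<close> is not an end of any segment of
  the chain.\<close>

lemma seg_chain_meet:
  assumes "adj u v" "successively adj xs" "u \<notin> set xs"
  shows "seg u v \<inter> chain seg xs \<subseteq> {v}"
proof
  fix z assume z: "z \<in> seg u v \<inter> chain seg xs"
  then have "z \<in> chain seg xs" by simp
  then obtain x y where xy: "x \<in> set xs" "y \<in> set xs" "adj x y" "z \<in> seg x y"
    using assms(2) by (rule in_chainE)
  then have "u \<notin> {x, y}" "{u, v} \<noteq> {x, y}" using assms(3) by auto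
  then show "z \<in> {v}" using seg_meet[OF assms(1) xy(3)] z xy(4) by auto
qed

lemma arc_in_chain:
  assumes "successively adj xs" "distinct xs" "2 \<le> length xs"
  shows "arc_in (realization \<Gamma>) (chain seg xs) (hd xs) (last xs)"
  using assms
proof (induction xs rule: induct_list012)
  case (3 x y zs)
  have xy: "adj x y" and yz: "successively adj (y # zs)" "distinct (y # zs)" and x: "x \<notin> set (y # zs)"
    using 3(3,4) by simp_all
  show ?case
  proof (cases "zs = []")
    case True
    then show ?thesis using arc_in_seg[OF xy] by simp
  next
    case False
    then have "2 \<le> length (y # zs)" by (simp add: Suc_le_eq)
    from 3(2)[OF yz this]
    have "arc_in (realization \<Gamma>) (chain seg (y # zs)) y (last (y # zs))" by simp
    from arc_in_join[OF arc_in_seg[OF xy] this seg_chain_meet[OF xy yz(1) x]] show ?thesis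
      by simp
  qed
qed simp_all

text \<open>Closedness of \<open>Z\<close> is recorded for \<open>open_interval_subset_loop\<close>.
  The last clause places each point of \<open>Z\<close> between two vertices of the cycle, which
  gives height bounds and disjointness.\<close>

lemma graph_cycle_simple_cycle:
  assumes "graph_cycle adj cs"
  obtains Z where "simple_cycle \<Gamma> Z" "closedin (realization \<Gamma>) Z" "seg (last cs) (hd cs) \<subseteq> Z"
    "set cs \<subseteq> Z" "\<And>z. z \<in> Z \<Longrightarrow> \<exists>x\<in>set cs. \<exists>y\<in>set cs. adj x y \<and> z \<in> seg x y"
proof -
  note c = assms[unfolded graph_cycle_def]
  obtain x y zs where cs: "cs = x # y # zs" "zs \<noteq> []"
  proof (cases cs rule: remdups_adj.cases)
    case (3 x y zs)
    then show ?thesis using that[of x y zs] c by (cases zs) auto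
  qed (use c in auto)
  define w where "w = last zs"
  have w: "w \<in> set zs" "last cs = w" using cs by (auto simp: w_def)
  have xy: "adj x y" and wx: "adj w x" and yz: "successively adj (y # zs)"
    using c w cs by auto
  have ne: "w \<noteq> y" "x \<notin> set (y # zs)" using c w cs by auto
  \<comment> \<open>The cycle is cut at \<open>w\<close> and \<open>y\<close> into the arc through
    \<open>x\<close> and the remaining chain; since \<open>x\<close> is not on the chain, the two
    share only their ends.\<close>
  let ?A = "seg w x \<union> seg x y" and ?B = "chain seg (y # zs)"
  have "{w, x} \<noteq> {x, y}" "w \<noteq> x" using ne w by (auto simp: doubleton_eq_iff)
  then have "seg w x \<inter> seg x y \<subseteq> {x}" using seg_meet[OF wx xy] ne by blast
  then have A: "arc_in (realization \<Gamma>) ?A w y"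
    by (rule arc_in_join[OF arc_in_seg[OF wx] arc_in_seg[OF xy]])
  have B: "arc_in (realization \<Gamma>) ?B y w"
    using arc_in_chain[OF yz] c cs by (cases zs) (auto simp: w_def)
  have "?A \<inter> ?B \<subseteq> {w, y}"
    using seg_chain_meet[OF xy yz ne(2)] seg_chain_meet[OF adj_sym[OF wx] yz ne(2)]
    by (auto simp: seg_commute)
  from arc_in_close_loop[OF A B this] have "simple_cycle \<Gamma> (?A \<union> ?B)"
    unfolding simple_cycle_def by blast
  moreover have "closedin (realization \<Gamma>) (?A \<union> ?B)"
    using closedin_seg[OF wx] closedin_seg[OF xy] closedin_chain[OF yz] by (intro closedin_Un)
  moreover have "\<exists>u\<in>set cs. \<exists>v\<in>set cs. adj u v \<and> z \<in> seg u v" if "z \<in> ?A \<union> ?B" for z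
  proof -
    consider "z \<in> seg w x" | "z \<in> seg x y" | "z \<in> ?B" using \<open>z \<in> ?A \<union> ?B\<close> by blast
    then show ?thesis
    proof cases
      case 3
      then show ?thesis using in_chainE[OF _ yz] cs by (metis list.set_intros(2))
    qed (use wx xy w cs in auto)
  qed
  moreover have "set cs \<subseteq> ?A \<union> ?B"
  proof -
    have "set us \<subseteq> chain seg us" if "successively adj us" "2 \<le> length us" for us
      using that
    proof (induction us rule: remdups_adj.induct)
      case (3 u v us)
      then show ?case using ends_in_seg[of u v] by (cases us) (auto split: if_splits)
    qed auto
    from this[OF yz] show ?thesis using ends_in_seg[OF xy] cs by (cases zs) auto
  qed
  ultimately show ?thesis using that[of "?A \<union> ?B"] cs(1) w(2) by auto
qed

end

section \<open>Half-edges and slopes on the subdivided graph\<close>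

context subdivision
begin

text \<open>The bridge from half-edges, on which \<open>val\<close> and \<open>slope\<close> are
  based, to neighbours under \<open>adj\<close>.\<close>

definition leads_to :: "'e \<times> real \<times> real \<Rightarrow> ('v, 'e) point \<Rightarrow> bool" where
  "leads_to = (\<lambda>(e, t, \<sigma>) y. \<sigma> = 1 \<and> (\<exists>b. piece e t b \<and> y = edge_pt \<Gamma> e b) \<or>
     \<sigma> = -1 \<and> (\<exists>a. piece e a t \<and> y = edge_pt \<Gamma> e a))"

lemma ex_leads_to:
  assumes x: "x \<in> nodes" and h: "h \<in> half_edges \<Gamma> x"
  shows "\<exists>y. leads_to h y"
proof -
  obtain e t \<sigma> where h': "h = (e, t, \<sigma>)" by (cases h)
  then have e: "e \<in> edges \<Gamma>" and t: "0 \<le> t" "t \<le> len \<Gamma> e" "edge_pt \<Gamma> e t = x"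
    and \<sigma>: "\<sigma> = 1 \<and> t < len \<Gamma> e \<or> \<sigma> = -1 \<and> 0 < t"
    using h by (auto simp: half_edges_def)
  \<comment> \<open>A node inside an edge can only come from a breakpoint of that edge; the ends of
    an edge are always breakpoints.\<close>
  have "t \<in> P e"
  proof (cases "0 < t \<and> t < len \<Gamma> e")
    case True
    then have "x = Inner e t" using t by (simp add: edge_pt_def)
    then obtain e' s where "e' \<in> edges \<Gamma>" "s \<in> P e'" "edge_pt \<Gamma> e' s = Inner e t"
      using x by (auto simp: nodes_def)
    then show ?thesis by (auto simp: edge_pt_def split: if_splits)
  qed (use P_ends[OF e] t in auto)
  then show ?thesis
    using \<sigma> ex_piece_after[OF e] ex_piece_before[OF e] by (auto simp: h' leads_to_def)
qed

lemma leads_to_adj: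
  assumes "h \<in> half_edges \<Gamma> x" "leads_to h y"
  shows "adj x y"
  using assms piece_adj adj_sym by (auto simp: leads_to_def half_edges_def)

text \<open>Simplicity of the subdivided graph enters here: distinct half-edges at a node yield
  distinct neighbours.\<close>

lemma leads_to_inj:
  assumes h: "h \<in> half_edges \<Gamma> x" "leads_to h y" and h': "h' \<in> half_edges \<Gamma> x" "leads_to h' y"
  shows "h = h'"
proof -
  have *: "\<exists>e a b. piece e a b \<and> (g = (e, a, 1) \<and> x = edge_pt \<Gamma> e a \<and> y = edge_pt \<Gamma> e b \<or>
     g = (e, b, -1) \<and> x = edge_pt \<Gamma> e b \<and> y = edge_pt \<Gamma> e a)"
    if "g \<in> half_edges \<Gamma> x" "leads_to g y" for g
    using that by (cases g) (auto simp: leads_to_def half_edges_def)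
  obtain e a b where p: "piece e a b" and g: "h = (e, a, 1) \<and> x = edge_pt \<Gamma> e a \<and> y = edge_pt \<Gamma> e b \<or>
     h = (e, b, -1) \<and> x = edge_pt \<Gamma> e b \<and> y = edge_pt \<Gamma> e a"
    using *[OF h] by auto
  obtain e' a' b' where p': "piece e' a' b'" and g': "h' = (e', a', 1) \<and> x = edge_pt \<Gamma> e' a' \<and> y = edge_pt \<Gamma> e' b' \<or>
     h' = (e', b', -1) \<and> x = edge_pt \<Gamma> e' b' \<and> y = edge_pt \<Gamma> e' a'"
    using *[OF h'] by auto
  have "e = e' \<and> a = a' \<and> b = b'"
    by (rule piece_unique[OF p p']) (use g g' in \<open>auto simp: insert_commute\<close>)
  then show ?thesis using g g' piece_ends_neq[OF p] by auto
qed

lemma slope_piece: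
  assumes p: "piece e a b"
    and m: "\<And>u. u \<in> {a..b} \<Longrightarrow> f (edge_pt \<Gamma> e u) = f (edge_pt \<Gamma> e a) + of_int m * (u - a)"
  shows "slope \<Gamma> f (e, a, 1) = m" "slope \<Gamma> f (e, b, -1) = -m"
proof -
  have ev: "\<forall>\<^sub>F s in at_right 0. 0 < s \<and> s < b - a"
    using pieceD(4)[OF p] by (auto simp: eventually_at_right_field intro!: exI[of _ "b - a"])
  show "slope \<Gamma> f (e, a, 1) = m"
  proof (rule slope_eqI, rule eventually_mono[OF ev])
    fix s assume "0 < s \<and> s < b - a"
    then show "f (edge_pt \<Gamma> e (a + 1 * s)) = f (edge_pt \<Gamma> e a) + of_int m * s"
      using m[of "a + s"] by simp
  qed
  show "slope \<Gamma> f (e, b, -1) = -m"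
  proof (rule slope_eqI, rule eventually_mono[OF ev])
    fix s assume s: "0 < s \<and> s < b - a"
    have "f (edge_pt \<Gamma> e (b - s)) = f (edge_pt \<Gamma> e a) + of_int m * (b - s - a)"
      "f (edge_pt \<Gamma> e b) = f (edge_pt \<Gamma> e a) + of_int m * (b - a)"
      using m[of "b - s"] m[of b] s by auto
    then show "f (edge_pt \<Gamma> e (b + -1 * s)) = f (edge_pt \<Gamma> e b) + of_int (-m) * s"
      by (simp add: algebra_simps)
  qed
qed

lemma slope_leads_to:
  assumes h: "h \<in> half_edges \<Gamma> x" "leads_to h y"
  shows "0 < slope \<Gamma> f h \<longleftrightarrow> f x < f y" "slope \<Gamma> f h = 0 \<longleftrightarrow> f x = f y"
proof -
  obtain e a b where p: "piece e a b" and g: "h = (e, a, 1) \<and> x = edge_pt \<Gamma> e a \<and> y = edge_pt \<Gamma> e b \<or>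
     h = (e, b, -1) \<and> x = edge_pt \<Gamma> e b \<and> y = edge_pt \<Gamma> e a"
    using h by (cases h) (auto simp: leads_to_def half_edges_def)
  obtain m :: int where m: "\<And>u. u \<in> {a..b} \<Longrightarrow> f (edge_pt \<Gamma> e u) = f (edge_pt \<Gamma> e a) + of_int m * (u - a)"
    using affine p unfolding piece_def by blast
  have b: "f (edge_pt \<Gamma> e b) = f (edge_pt \<Gamma> e a) + of_int m * (b - a)" and ab: "0 < b - a"
    using m[of b] pieceD(4)[OF p] by auto
  note sl = slope_piece[OF p m]
  show "0 < slope \<Gamma> f h \<longleftrightarrow> f x < f y" "slope \<Gamma> f h = 0 \<longleftrightarrow> f x = f y"
    using g sl b ab by (auto simp: zero_less_mult_iff mult_less_0_iff)
qed

end

text \<open>If infinitely many half-edges met at a point, both \<open>val\<close> and \<open>ord_at\<close> would be the junk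
  value 0, so effectiveness forces finiteness.\<close>

lemma sum_Suc_slope:
  assumes "0 \<le> canonical_divisor \<Gamma> x + principal_divisor \<Gamma> f x" "x \<in> points \<Gamma>"
  shows "finite (half_edges \<Gamma> x)" "2 \<le> (\<Sum>h\<in>half_edges \<Gamma> x. 1 + slope \<Gamma> f h)"
proof -
  have *: "2 \<le> int (card (half_edges \<Gamma> x)) + (\<Sum>h\<in>half_edges \<Gamma> x. slope \<Gamma> f h)"
    using assms by (simp add: canonical_divisor_def principal_divisor_def val_def ord_at_def)
  then show fin: "finite (half_edges \<Gamma> x)"
    by (metis add_0 card.infinite of_nat_0 sum.infinite zero_neq_numeral zero_le_numeral order_antisym)
  show "2 \<le> (\<Sum>h\<in>half_edges \<Gamma> x. 1 + slope \<Gamma> f h)"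
    using * by (simp add: sum.distrib)
qed

text \<open>For nonpositive integer slopes the term \<open>1 + s h\<close> is 1 if the slope
  vanishes and at most 0 otherwise, so the sum is bounded by the number of flat half-edges.\<close>

lemma two_flat_half_edges:
  assumes "finite H" "2 \<le> (\<Sum>h\<in>H. 1 + s h)" "\<And>h. h \<in> H \<Longrightarrow> s h \<le> (0::int)"
  shows "\<exists>h\<in>H. \<exists>h'\<in>H. h \<noteq> h' \<and> s h = 0 \<and> s h' = 0"
proof -
  let ?Z = "{h \<in> H. s h = 0}"
  have "(\<Sum>h\<in>H. 1 + s h) \<le> (\<Sum>h\<in>H. if s h = 0 then 1 else 0)"
    using assms(3) by (intro sum_mono) force
  also have "\<dots> = int (card ?Z)"
    using assms(1) by (simp add: sum.If_cases Int_def)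
  finally have "\<not> card ?Z \<le> Suc 0" using assms(2) by simp
  moreover have "finite ?Z" using assms(1) by simp
  ultimately show ?thesis using card_le_Suc0_iff_eq[of ?Z] by blast
qed

text \<open>With no zero slopes, every descending term \<open>1 + s h\<close> is at most 0; all of
  them except that of \<open>i\<close> are dropped. The slope of \<open>i\<close> outweighs the
  ascending slopes by at least 1, which cancels the remaining 1, so the lower bound 2 must come from
  the number of ascending half-edges.\<close>

lemma two_ascending_half_edges:
  assumes fin: "finite H" and sum: "2 \<le> (\<Sum>h\<in>H. 1 + s h)" and nz: "\<And>h. h \<in> H \<Longrightarrow> s h \<noteq> (0::int)"
    and i: "i \<in> H" "s i < 0" "(\<Sum>j | j \<in> H \<and> 0 < s j. s j) < - s i"
  shows "\<exists>h\<in>H. \<exists>h'\<in>H. h \<noteq> h' \<and> 0 < s h \<and> 0 < s h'"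
proof -
  let ?U = "{h \<in> H. 0 < s h}"
  have finU: "finite ?U" using fin by simp
  have "(\<Sum>h\<in>H. 1 + s h) = (1 + s i) + (\<Sum>h\<in>H - {i}. 1 + s h)"
    using fin i(1) by (rule sum.remove)
  also have "(\<Sum>h\<in>H - {i}. 1 + s h) \<le> (\<Sum>h\<in>H - {i}. if 0 < s h then 1 + s h else 0)"
  proof (rule sum_mono)
    fix h assume "h \<in> H - {i}"
    then show "1 + s h \<le> (if 0 < s h then 1 + s h else 0)" using nz[of h] by auto
  qed
  also have "\<dots> = (\<Sum>h\<in>?U. 1 + s h)"
    using fin i(2) by (intro sum.mono_neutral_cong_right) auto
  also have "\<dots> = int (card ?U) + (\<Sum>h\<in>?U. s h)"
    by (simp add: sum.distrib)
  finally have "\<not> card ?U \<le> Suc 0" using sum i(3) by linarith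
  then show ?thesis using card_le_Suc0_iff_eq[OF finU] by blast
qed

section \<open>Horizontal cycles and the realizability conditions on a subdivision\<close>

locale effective_subdivision = subdivision +
  assumes eff: "0 \<le> canonical_divisor \<Gamma> x + principal_divisor \<Gamma> f x"
begin

text \<open>Without ascending neighbours all slopes at \<open>x\<close> are nonpositive, so
  effectiveness leaves two flat half-edges, and these lead to two distinct neighbours.\<close>

sublocale height_graph nodes adj f
proof
  fix x assume x: "x \<in> nodes" and le: "\<And>y. adj x y \<Longrightarrow> f y \<le> f x"
  have xp: "x \<in> points \<Gamma>" using x nodes_subset_points by blast
  have "slope \<Gamma> f h \<le> 0" if "h \<in> half_edges \<Gamma> x" for h
    using ex_leads_to[OF x that] slope_leads_to(1)[OF that] leads_to_adj[OF that] le by (meson not_less)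
  from two_flat_half_edges[OF sum_Suc_slope[OF eff xp] this]
  obtain h h' where h: "h \<in> half_edges \<Gamma> x" "h' \<in> half_edges \<Gamma> x" "h \<noteq> h'"
    "slope \<Gamma> f h = 0" "slope \<Gamma> f h' = 0" by blast
  obtain y y' where y: "leads_to h y" "leads_to h' y'" using ex_leads_to[OF x] h(1,2) by blast
  then have "y \<noteq> y'" using leads_to_inj h by metis
  moreover have "adj x y" "adj x y'" "f y = f x" "f y' = f x"
    using leads_to_adj slope_leads_to(2) h y by metis+
  ultimately show "\<exists>y z. y \<noteq> z \<and> adj x y \<and> adj x z \<and> f y = f x \<and> f z = f x" by blast
qed (use finite_nodes adj_in_nodes adj_irrefl adj_sym in auto)

context
  assumes no_disjoint:
    "\<not> (\<exists>Z Z'. horizontal_cycle \<Gamma> f Z \<and> horizontal_cycle \<Gamma> f Z' \<and> Z \<inter> Z' = {})"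
begin

text \<open>Graph cycles without a common vertex give disjoint curves, because segments with no
  common end are disjoint; \<open>no_disjoint\<close> excludes this for flat cycles.\<close>

lemma flat_cycles_meet:
  assumes "flat_cycle cs" "flat_cycle ds"
  shows "set cs \<inter> set ds \<noteq> {}"
proof
  assume dis: "set cs \<inter> set ds = {}"
  have hor: "\<exists>Z. horizontal_cycle \<Gamma> f Z \<and> (\<forall>z\<in>Z. \<exists>x\<in>set cs. \<exists>y\<in>set cs. adj x y \<and> z \<in> seg x y)"
    if flat: "flat_cycle cs" for cs
  proof -
    obtain c where cs: "graph_cycle adj cs" "\<And>x. x \<in> set cs \<Longrightarrow> f x = c"
      using flat unfolding flat_cycle_def by blast
    obtain Z where Z: "simple_cycle \<Gamma> Z" "\<And>z. z \<in> Z \<Longrightarrow> \<exists>x\<in>set cs. \<exists>y\<in>set cs. adj x y \<and> z \<in> seg x y"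
      using graph_cycle_simple_cycle[OF cs(1)] by metis
    have "f z = c" if z: "z \<in> Z" for z
    proof -
      obtain x y where "x \<in> set cs" "y \<in> set cs" "adj x y" "z \<in> seg x y" using Z(2)[OF z] by blast
      then show ?thesis using f_on_seg[of x y z] cs(2) by simp
    qed
    then show ?thesis using Z unfolding horizontal_cycle_def by blast
  qed
  obtain Z Z' where Z: "horizontal_cycle \<Gamma> f Z" "horizontal_cycle \<Gamma> f Z'"
    and *: "\<And>z. z \<in> Z \<Longrightarrow> \<exists>x\<in>set cs. \<exists>y\<in>set cs. adj x y \<and> z \<in> seg x y"
     "\<And>z. z \<in> Z' \<Longrightarrow> \<exists>x\<in>set ds. \<exists>y\<in>set ds. adj x y \<and> z \<in> seg x y"
    using hor[OF assms(1)] hor[OF assms(2)] by blast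
  have "z \<notin> Z'" if z: "z \<in> Z" for z
  proof
    assume "z \<in> Z'"
    obtain x y where xy: "x \<in> set cs" "y \<in> set cs" "adj x y" "z \<in> seg x y" using *(1)[OF z] by blast
    obtain u v where uv: "u \<in> set ds" "v \<in> set ds" "adj u v" "z \<in> seg u v"
      using *(2)[OF \<open>z \<in> Z'\<close>] by blast
    have "{x, y} \<inter> {u, v} = {}" using xy(1,2) uv(1,2) dis by blast
    then show False using seg_meet[OF xy(3) uv(3)] xy(4) uv(4) by blast
  qed
  then show False using no_disjoint Z by blast
qed

lemma inconvenient_in_cycle:
  assumes v: "v \<in> nodes" "inconvenient \<Gamma> f v"
  shows "\<exists>Z. simple_cycle \<Gamma> Z \<and> v \<in> Z \<and> (\<forall>x\<in>Z. f v \<le> f x)"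
proof -
  have vp: "v \<in> points \<Gamma>" using v(1) nodes_subset_points by blast
  obtain i where i: "i \<in> half_edges \<Gamma> v" "slope \<Gamma> f i < 0"
    "(\<Sum>j | j \<in> half_edges \<Gamma> v \<and> 0 < slope \<Gamma> f j. slope \<Gamma> f j) < - slope \<Gamma> f i"
    and nz: "\<And>h. h \<in> half_edges \<Gamma> v \<Longrightarrow> slope \<Gamma> f h \<noteq> 0"
    using v(2) unfolding inconvenient_def by blast
  obtain h h' where h: "h \<in> half_edges \<Gamma> v" "h' \<in> half_edges \<Gamma> v" "h \<noteq> h'"
    "0 < slope \<Gamma> f h" "0 < slope \<Gamma> f h'"
    using two_ascending_half_edges[OF sum_Suc_slope[OF eff vp] nz i] by blast
  obtain y y' where y: "leads_to h y" "leads_to h' y'" using ex_leads_to[OF v(1)] h(1,2) by blast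
  then have "y \<noteq> y'" using leads_to_inj h by metis
  moreover have "adj v y" "f v < f y" "adj v y'" "f v < f y'"
    using leads_to_adj slope_leads_to(1) h y by metis+
  ultimately obtain cs where cs: "graph_cycle adj cs" "v \<in> set cs" "\<And>x. x \<in> set cs \<Longrightarrow> f v \<le> f x"
    using cycle_through_two_ascents[OF flat_cycles_meet] by metis
  obtain Z where Z: "simple_cycle \<Gamma> Z" "set cs \<subseteq> Z"
    "\<And>z. z \<in> Z \<Longrightarrow> \<exists>x\<in>set cs. \<exists>y\<in>set cs. adj x y \<and> z \<in> seg x y"
    using graph_cycle_simple_cycle[OF cs(1)] by metis
  have "f v \<le> f z" if z: "z \<in> Z" for z
  proof -
    obtain x y where "x \<in> set cs" "y \<in> set cs" "adj x y" "z \<in> seg x y" using Z(3)[OF z] by blast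
    then show ?thesis using f_on_seg(1)[of x y z] cs(3)[of x] cs(3)[of y] by auto
  qed
  then show ?thesis using Z(1,2) cs(2) by blast
qed

lemma ex_piece_through:
  assumes "x \<in> points \<Gamma>" "x \<notin> nodes"
  shows "\<exists>e a b. piece e a b \<and> x \<in> edge_pt \<Gamma> e ` {a..b}"
proof -
  obtain e t where t: "e \<in> edges \<Gamma>" "0 < t" "t < len \<Gamma> e" "x = Inner e t"
    using assms by (auto simp: points_def nodes_def)
  obtain a b where ab: "piece e a b" "t \<in> {a..b}"
    using ex_piece_containing[of e t] t by auto
  have "x = edge_pt \<Gamma> e t" using t by (simp add: edge_pt_def)
  with ab show ?thesis by blast
qed

lemma finite_pieces: "finite {(e, a, b). piece e a b}"
proof (rule finite_subset)
  show "{(e, a, b). piece e a b} \<subseteq> (SIGMA e:edges \<Gamma>. P e \<times> P e)" by (auto simp: piece_def)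
  show "finite (SIGMA e:edges \<Gamma>. P e \<times> P e)"
    using graph finite_P by (auto simp: metric_graph_def)
qed

text \<open>\<open>E\<close> need not be a piece of the subdivision. It suffices to find a flat
  piece that meets \<open>E\<close> and a cycle through that piece: the cycle then contains all of
  \<open>E\<close>.\<close>

lemma horizontal_edge_in_cycle:
  assumes op: "openin (realization \<Gamma>) E" and conn: "connectedin (realization \<Gamma>) E"
    and hom: "subtopology (realization \<Gamma>) E homeomorphic_space top_of_set {0<..<1::real}"
    and c: "\<And>y. y \<in> E \<Longrightarrow> f y = c"
  shows "\<exists>Z. simple_cycle \<Gamma> Z \<and> E \<subseteq> Z \<and> (\<forall>x\<in>Z. c \<le> f x)"
proof -
  have E: "E \<subseteq> points \<Gamma>" using op by (simp add: openin_realization)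
  have "infinite E"
  proof
    assume fin: "finite E"
    obtain \<phi> where "homeomorphic_map (subtopology (realization \<Gamma>) E) (top_of_set {0<..<1::real}) \<phi>"
      using hom unfolding homeomorphic_space by blast
    then have "\<phi> ` (points \<Gamma> \<inter> E) = {0<..<1}"
      using homeomorphic_imp_surjective_map by (fastforce simp: topspace_realization[OF graph])
    then have "finite {0<..<1::real}" using fin by (metis finite_Int finite_imageI)
    then show False using infinite_Ioo[of 0 "1::real"] by simp
  qed
  \<comment> \<open>Pigeonhole: infinitely many points of \<open>E\<close> are spread over finitely
    many pieces.\<close>
  then have "infinite (E - nodes)" using finite_nodes by simp
  obtain e a b where p: "piece e a b" and inf: "infinite (E \<inter> edge_pt \<Gamma> e ` {a..b})"
  proof -
    let ?Q = "{(e, a, b). piece e a b}" and ?C = "\<lambda>(e, a, b). E \<inter> edge_pt \<Gamma> e ` {a..b}"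
    have "E - nodes \<subseteq> (\<Union>q\<in>?Q. ?C q)"
    proof
      fix x assume x: "x \<in> E - nodes"
      then obtain e a b where "piece e a b" "x \<in> edge_pt \<Gamma> e ` {a..b}"
        using ex_piece_through[of x] E by blast
      then show "x \<in> (\<Union>q\<in>?Q. ?C q)" using x by (intro UN_I[of "(e, a, b)"]) auto
    qed
    then have "infinite (\<Union>q\<in>?Q. ?C q)" using \<open>infinite (E - nodes)\<close> by (rule infinite_super)
    then have "\<not> (\<forall>q\<in>?Q. finite (?C q))" using finite_UN_I[OF finite_pieces, of ?C] by blast
    then show ?thesis using that by auto
  qed
  obtain x where x: "x \<in> E \<inter> edge_pt \<Gamma> e ` {a..b}"
    using infinite_imp_nonempty[OF inf] by auto
  obtain y where y: "y \<in> E \<inter> edge_pt \<Gamma> e ` {a..b}" "y \<noteq> x"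
    using infinite_imp_nonempty[OF infinite_remove[OF inf, of x]] by auto
  obtain s where s: "s \<in> {a..b}" "x = edge_pt \<Gamma> e s" using x by blast
  obtain t where t: "t \<in> {a..b}" "y = edge_pt \<Gamma> e t" using y by blast
  obtain m :: int where m: "\<And>u. u \<in> {a..b} \<Longrightarrow> f (edge_pt \<Gamma> e u) = f (edge_pt \<Gamma> e a) + of_int m * (u - a)"
    using affine p unfolding piece_def by blast
  \<comment> \<open>Two distinct points of equal height on an affine piece force slope 0, also where
    the piece may leave \<open>E\<close>.\<close>
  have "of_int m * (s - a) = of_int m * (t - a)" "s \<noteq> t"
    using m[OF s(1)] m[OF t(1)] c x y s t by auto
  then have "m = 0" by simp
  then have flat: "f (edge_pt \<Gamma> e a) = c" "f (edge_pt \<Gamma> e b) = c"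
    using m[OF s(1)] m[of b] c x s pieceD(4)[OF p] by auto
  obtain cs where cs: "graph_cycle adj cs" "hd cs = edge_pt \<Gamma> e a" "last cs = edge_pt \<Gamma> e b"
    "\<And>x. x \<in> set cs \<Longrightarrow> c \<le> f x"
    using cycle_through_flat_edge[OF flat_cycles_meet piece_adj[OF p]] flat by metis
  obtain Z where Z: "simple_cycle \<Gamma> Z" "closedin (realization \<Gamma>) Z" "seg (last cs) (hd cs) \<subseteq> Z"
    "\<And>z. z \<in> Z \<Longrightarrow> \<exists>x\<in>set cs. \<exists>y\<in>set cs. adj x y \<and> z \<in> seg x y"
    using graph_cycle_simple_cycle[OF cs(1)] by metis
  have "x \<in> Z" using Z(3) x unfolding cs seg_commute[of "edge_pt \<Gamma> e b"] seg_piece[OF p] by blast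
  moreover obtain g where g: "pathin (realization \<Gamma>) g" "g 0 = g 1" "inj_on g {0..<1}" "Z = g ` {0..1}"
    using Z(1) unfolding simple_cycle_def by blast
  ultimately have "E \<subseteq> Z"
    using open_interval_subset_loop[OF hom conn op g(1-3)] Z(2) x by blast
  moreover have "c \<le> f z" if z: "z \<in> Z" for z
  proof -
    obtain x y where "x \<in> set cs" "y \<in> set cs" "adj x y" "z \<in> seg x y" using Z(4)[OF z] by blast
    then show ?thesis using f_on_seg(1)[of x y z] cs(4)[of x] cs(4)[of y] by auto
  qed
  ultimately show ?thesis using Z(1) by blast
qed

end

end

section \<open>Choice of breakpoints and conclusion\<close>

lemma ex_effective_subdivision:
  assumes G: "metric_graph \<Gamma>" and f: "rational_function \<Gamma> f"
    and eff: "\<And>x. 0 \<le> canonical_divisor \<Gamma> x + principal_divisor \<Gamma> f x"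
    and S: "finite S" "S \<subseteq> points \<Gamma>"
  obtains P where "effective_subdivision \<Gamma> f P" "S \<subseteq> subdivision.nodes \<Gamma> P"
proof -
  have "\<forall>e\<in>edges \<Gamma>. \<exists>T. finite T \<and> (\<forall>s t. 0 \<le> s \<longrightarrow> s < t \<longrightarrow> t \<le> len \<Gamma> e \<longrightarrow> {s<..<t} \<inter> T = {} \<longrightarrow>
        (\<exists>m::int. \<forall>u\<in>{s..t}. f (edge_pt \<Gamma> e u) = f (edge_pt \<Gamma> e s) + of_int m * (u - s)))"
    using f by (simp add: rational_function_def piecewise_int_affine_def)
  then obtain T where T: "\<And>e. e \<in> edges \<Gamma> \<Longrightarrow> finite (T e)"
    and lin: "\<And>e s t. e \<in> edges \<Gamma> \<Longrightarrow> 0 \<le> s \<Longrightarrow> s < t \<Longrightarrow> t \<le> len \<Gamma> e \<Longrightarrow> {s<..<t} \<inter> T e = {} \<Longrightarrow>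
        \<exists>m::int. \<forall>u\<in>{s..t}. f (edge_pt \<Gamma> e u) = f (edge_pt \<Gamma> e s) + of_int m * (u - s)"
    by metis
  \<comment> \<open>The thirds are the two interior breakpoints, \<open>T e\<close> makes
    \<open>f\<close> affine on pieces, and the preimage of \<open>S\<close> turns the points of
    \<open>S\<close> into nodes. The intersection discards elements of \<open>T e\<close> beyond the
    edge.\<close>
  define P where "P e = {0..len \<Gamma> e} \<inter>
    ({0, len \<Gamma> e / 3, 2 * len \<Gamma> e / 3, len \<Gamma> e} \<union> T e \<union> Inner e -` S)" for e
  have pos: "0 < len \<Gamma> e" if "e \<in> edges \<Gamma>" for e using G that by (simp add: metric_graph_def)
  interpret effective_subdivision \<Gamma> f P
  proof
    fix e assume e: "e \<in> edges \<Gamma>"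
    show "finite (P e)" unfolding P_def
      using T[OF e] finite_vimageI[OF S(1), of "Inner e"] by (simp add: inj_def)
    show "P e \<subseteq> {0..len \<Gamma> e}" by (simp add: P_def)
    show "{0, len \<Gamma> e} \<subseteq> P e" using pos[OF e] by (simp add: P_def)
    show "\<exists>s\<in>P e. \<exists>t\<in>P e. 0 < s \<and> s < t \<and> t < len \<Gamma> e"
      by (rule bexI[of _ "len \<Gamma> e / 3"], rule bexI[of _ "2 * len \<Gamma> e / 3"]) (use pos[OF e] in \<open>auto simp: P_def\<close>)
    fix a b assume ab: "a \<in> P e" "b \<in> P e" "a < b" "{a<..<b} \<inter> P e = {}"
    then have "{a<..<b} \<inter> T e = {}" by (fastforce simp: P_def)
    then show "\<exists>m::int. \<forall>u\<in>{a..b}. f (edge_pt \<Gamma> e u) = f (edge_pt \<Gamma> e a) + of_int m * (u - a)"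
      using ab by (intro lin[OF e]) (auto simp: P_def)
  qed (use G eff in auto)
  have "S \<subseteq> nodes"
  proof
    fix x assume x: "x \<in> S"
    then consider v where "v \<in> verts \<Gamma>" "x = Vertex v" | e t where "e \<in> edges \<Gamma>" "0 < t" "t < len \<Gamma> e" "x = Inner e t"
      using S(2) by (auto simp: points_def)
    then show "x \<in> nodes"
    proof cases
      case 1
      then show ?thesis by (simp add: nodes_def)
    next
      case 2
      then have "t \<in> P e" "x = edge_pt \<Gamma> e t" using x by (auto simp: P_def edge_pt_def)
      with 2(1) show ?thesis by (auto simp: nodes_def)
    qed
  qed
  then show ?thesis using that effective_subdivision_axioms by blast
qed

theorem proposition3p27:
  fixes \<Gamma> :: "('v, 'e) metric_graph"
    and f :: "('v, 'e) point \<Rightarrow> real"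
    and D :: "('v, 'e) point \<Rightarrow> int"
  assumes "metric_graph \<Gamma>"
    and "connected_space (realization \<Gamma>)"
    and "rational_function \<Gamma> f"
    and "D = (\<lambda>x. canonical_divisor \<Gamma> x + principal_divisor \<Gamma> f x)"
    and "effective D"
    and "\<not> (\<exists>Z Z'. horizontal_cycle \<Gamma> f Z \<and> horizontal_cycle \<Gamma> f Z' \<and> Z \<inter> Z' = {})"
  shows "realizable \<Gamma> D f"
proof -
  have "(\<forall>v\<in>S. inconvenient \<Gamma> f v \<longrightarrow> (\<exists>Z. simple_cycle \<Gamma> Z \<and> v \<in> Z \<and> (\<forall>x\<in>Z. f v \<le> f x))) \<and>
    (\<forall>E\<in>model_edges \<Gamma> S. \<forall>c. (\<forall>y\<in>E. f y = c) \<longrightarrow> (\<exists>Z. simple_cycle \<Gamma> Z \<and> E \<subseteq> Z \<and> (\<forall>x\<in>Z. c \<le> f x)))"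
    if S: "is_model \<Gamma> S" for S
  proof -
    have fin: "finite S" and sub: "S \<subseteq> points \<Gamma>" using S by (auto simp: is_model_def)
    \<comment> \<open>The subdivision depends on the model: each vertex of the model must become a
      node.\<close>
    obtain P where P: "effective_subdivision \<Gamma> f P" "S \<subseteq> subdivision.nodes \<Gamma> P"
      using ex_effective_subdivision[OF assms(1,3) _ fin sub] assms(4,5) by (metis effective_def)
    interpret effective_subdivision \<Gamma> f P by (rule P(1))
    show ?thesis
    proof (intro conjI ballI allI impI)
      fix v assume "v \<in> S" "inconvenient \<Gamma> f v"
      then show "\<exists>Z. simple_cycle \<Gamma> Z \<and> v \<in> Z \<and> (\<forall>x\<in>Z. f v \<le> f x)"
        using inconvenient_in_cycle[OF assms(6)] P(2) by blast
    next
      fix E c assume E: "E \<in> model_edges \<Gamma> S" and c: "\<forall>y\<in>E. f y = c"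
      have "connectedin (subtopology (realization \<Gamma>) (points \<Gamma> - S)) E"
        using E unfolding model_edges_def by (rule connectedin_connected_components_of)
      then have "connectedin (realization \<Gamma>) E" by (simp add: connectedin_subtopology)
      moreover have "subtopology (realization \<Gamma>) E homeomorphic_space top_of_set {0<..<1::real}"
        using S E by (auto simp: is_model_def)
      ultimately show "\<exists>Z. simple_cycle \<Gamma> Z \<and> E \<subseteq> Z \<and> (\<forall>x\<in>Z. c \<le> f x)"
        using horizontal_edge_in_cycle[OF assms(6) openin_model_edge[OF assms(1) fin E]] c by blast
    qed
  qed
  then show ?thesis using assms(3-5) unfolding realizable_def by blast
qed

end
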